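(* The cyclic peak set $\operatorname{cPk}$ is cyclic shuffle-compatible, and the linear map on $\mathcal{A}_{\operatorname{cPk}}^{\mathrm{cyc}}$ defined by $[\pi]_{\operatorname{cPk}}\mapsto K_{|\pi|,\operatorname{cPk}[\pi]}^{\mathrm{cyc}}$ is a $\mathbb{Q}$-algebra isomorphism from $\mathcal{A}_{\operatorname{cPk}}^{\mathrm{cyc}}$ to the algebra of cyclic peaks $\Lambda$.
   Context: A (linear) permutation of length $n\ge 0$ is a sequence $\pi=\pi_1\cdots\pi_n$ of $n$ distinct positive integers; $|\pi|=n$; $\mathfrak{P}_n$ is the set of permutations of length $n$. Two permutations are disjoint if they have no letter in common, and have the same relative order if they have the same standardization (replace the $i$th smallest letter by $i$). For disjoint $\pi\in\mathfrak{P}_m$, $\sigma\in\mathfrak{P}_n$, $\operatorname{Sh}(\pi,\sigma)$ is the set of $\tau\in\mathfrak{P}_{m+n}$ having both $\pi$ and $\sigma$ as subsequences. The cyclic permutation $[\pi]$ is the set of all rotations of $\pi$; its length is $|\pi|$. A cyclic permutation statistic is a function $\operatorname{cst}$ on cyclic permutations with $\operatorname{cst}[\pi]=\operatorname{cst}[\sigma]$ whenever $\pi,\sigma$ have the same relative order. For disjoint $\pi,\sigma$, $\operatorname{cSh}([\pi],[\sigma])$ is the set of all $[\tau]$ with $\tau\in\operatorname{Sh}(\bar\pi,\bar\sigma)$ for some $\bar\pi\in[\pi]$, $\bar\sigma\in[\sigma]$. The statistic $\operatorname{cst}$ is cyclic shuffle-compatible if for disjoint $\pi,\sigma$ the multiset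 $\{\{\operatorname{cst}[\tau]:[\tau]\in\operatorname{cSh}([\pi],[\sigma])\}\}$ depends only on $\operatorname{cst}[\pi],\operatorname{cst}[\sigma],|\pi|,|\sigma|$. $[\pi]_{\operatorname{cst}}$ denotes the equivalence class of $[\pi]$ under: $[\pi]\sim[\sigma]$ iff $\operatorname{cst}[\pi]=\operatorname{cst}[\sigma]$ and $|\pi|=|\sigma|$. $\mathcal{A}^{\mathrm{cyc}}_{\operatorname{cst}}$ is the $\mathbb{Q}$-vector space with basis these classes; when $\operatorname{cst}$ is cyclic shuffle-compatible it is a $\mathbb{Q}$-algebra with multiplication $[\pi]_{\operatorname{cst}}[\sigma]_{\operatorname{cst}}=\sum_{[\tau]\in\operatorname{cSh}([\pi],[\sigma])}[\tau]_{\operatorname{cst}}$ for $\pi,\sigma$ disjoint. For $\pi\in\mathfrak{P}_n$: $\operatorname{Pk}\pi=\{i\in\{2,\dots,n-1\}:\pi_{i-1}<\pi_i>\pi_{i+1}\}$ and $\operatorname{cPk}\pi=\{i\in[n]:\pi_{i-1}<\pi_i>\pi_{i+1}\}$, with indices modulo $n$ in the latter. The cyclic statistic is the multiset $\operatorname{cPk}[\pi]=\{\{\operatorname{cPk}\bar\pi:\bar\pi\in[\pi]\}\}$, which consists of all cyclic shifts $\operatorname{cPk}\pi+i$, $i\in[n]$ (values modulo $n$). Peak quasisymmetric functions (Stembridge): for $T\subseteq[n-1]$ let $F_{n,T}=\sum x_{i_1}\cdots x_{i_n}$ over $i_1\le\cdots\le i_n$ with $i_j<i_{j+1}$ if $j\in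 T$. For $n\ge1$ and $S$ the peak set of some permutation in $\mathfrak{P}_n$, $K_{n,S}=2^{|S|+1}\sum F_{n,T}$, summed over all $T\subseteq[n-1]$ with $S\subseteq T\,\triangle\,(T+1)$, where $T+1=\{t+1:t\in T\}$ (no reduction modulo $n$) and $\triangle$ is symmetric difference; $K_{0,\emptyset}=1$. A cyclic peak set of $[n]$ is a set of the form $\operatorname{cPk}\pi$, $\pi\in\mathfrak{P}_n$. For such $S=\operatorname{cPk}\pi$, $$K^{\mathrm{cyc}}_{n,S}=\sum_{i\in[n]}K_{n,(S+i)\setminus\{1,n\}}=\sum_{\bar\pi\in[\pi]}K_{n,\operatorname{Pk}\bar\pi}\quad(n\ge1),\qquad K^{\mathrm{cyc}}_{0,\emptyset}=1,$$ which is invariant under cyclic shifts of $S$; $K^{\mathrm{cyc}}_{n,\operatorname{cPk}[\pi]}$ means $K^{\mathrm{cyc}}_{n,\operatorname{cPk}\pi}$. $\Lambda$ is the $\mathbb{Q}$-span of all $K^{\mathrm{cyc}}_{n,S}$, $n\ge0$, $S$ a cyclic peak set of $[n]$, inside $\mathbb{Q}[[x_1,x_2,\dots]]$. *)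

theory Defs
  imports
    "HOL-Library.Multiset"
    "HOL-Library.Sublist"
    "HOL-Library.Poly_Mapping"
    "HOL-Algebra.Algebraic_Closure_Type"
begin

section \<open>Permutations and cyclic permutations\<close>

definition perms :: "nat list set" where
  "perms = {p. distinct p \<and> 0 \<notin> set p}"

definition standardize :: "nat list \<Rightarrow> nat list" where
  "standardize p = map (\<lambda>x. card {y \<in> set p. y \<le> x}) p"

definition Sh :: "nat list \<Rightarrow> nat list \<Rightarrow> nat list set" where
  "Sh p q = {t \<in> perms. length t = length p + length q \<and> subseq p t \<and> subseq q t}"

definition cyc :: "nat list \<Rightarrow> nat list set" where
  "cyc p = {rotate k p | k. True}"

definition cyclic_perms :: "nat list set set" where
  "cyclic_perms = cyc ` perms"

text \<open>On a cyclic permutation all members have the same length.\<close>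

definition cyc_length :: "nat list set \<Rightarrow> nat" where
  "cyc_length c = length (SOME p. p \<in> c)"

definition cyc_disjoint :: "nat list set \<Rightarrow> nat list set \<Rightarrow> bool" where
  "cyc_disjoint c d \<longleftrightarrow> (\<forall>p\<in>c. \<forall>q\<in>d. set p \<inter> set q = {})"

definition cSh :: "nat list set \<Rightarrow> nat list set \<Rightarrow> nat list set set" where
  "cSh c d = {cyc t | t. \<exists>p\<in>c. \<exists>q\<in>d. t \<in> Sh p q}"

section \<open>Cyclic statistics and shuffle-compatibility\<close>

definition cyclic_statistic :: "(nat list set \<Rightarrow> 's) \<Rightarrow> bool" where
  "cyclic_statistic cst \<longleftrightarrow>
     (\<forall>p\<in>perms. \<forall>q\<in>perms. standardize p = standardize q \<longrightarrow> cst (cyc p) = cst (cyc q))"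

text \<open>
  The sets \<open>cSh c d\<close> with \<open>c\<close>, \<open>d\<close> disjoint are finite (lemma \<open>finite_cSh\<close> below), so
  \<open>mset_set\<close> takes each of their elements exactly once.
\<close>

definition cyclic_shuffle_compatible :: "(nat list set \<Rightarrow> 's) \<Rightarrow> bool" where
  "cyclic_shuffle_compatible cst \<longleftrightarrow> cyclic_statistic cst \<and>
     (\<forall>c\<in>cyclic_perms. \<forall>d\<in>cyclic_perms. \<forall>c'\<in>cyclic_perms. \<forall>d'\<in>cyclic_perms.
        cyc_disjoint c d \<longrightarrow> cyc_disjoint c' d' \<longrightarrow>
        cst c = cst c' \<longrightarrow> cst d = cst d' \<longrightarrow>
        cyc_length c = cyc_length c' \<longrightarrow> cyc_length d = cyc_length d' \<longrightarrow>
        image_mset cst (mset_set (cSh c d)) = image_mset cst (mset_set (cSh c' d')))"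

definition cyc_class :: "(nat list set \<Rightarrow> 's) \<Rightarrow> nat list set \<Rightarrow> nat list set set" where
  "cyc_class cst c = {d \<in> cyclic_perms. cst d = cst c \<and> cyc_length d = cyc_length c}"

section \<open>The cyclic shuffle algebra\<close>

abbreviation rat_ring :: "rat ring" where
  "rat_ring \<equiv> ring_of_type_algebra"

text \<open>
  Elements are finitely supported rational functions on the set of classes.  The product of
  two basis elements is computed from an arbitrary choice of disjoint representatives;
  lemma \<open>cyc_algebra_basis_mult\<close> below shows that for shuffle-compatible statistics every
  other choice gives the same result.
\<close>

abbreviation basis :: "'k \<Rightarrow> 'k \<Rightarrow>\<^sub>0 rat" where
  "basis C \<equiv> Poly_Mapping.single C 1"

definition class_mult ::
    "(nat list set \<Rightarrow> 's) \<Rightarrow> nat list set set \<Rightarrow> nat list set set \<Rightarrow> nat list set set \<Rightarrow>\<^sub>0 rat" where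
  "class_mult cst C D =
     (let (c, d) = (SOME (c, d). c \<in> C \<and> d \<in> D \<and> cyc_disjoint c d)
      in \<Sum>t\<in>cSh c d. basis (cyc_class cst t))"

definition cyc_algebra ::
    "(nat list set \<Rightarrow> 's) \<Rightarrow> (rat, nat list set set \<Rightarrow>\<^sub>0 rat) module" where
  "cyc_algebra cst =
     \<lparr> carrier = {a. Poly_Mapping.keys a \<subseteq> cyc_class cst ` cyclic_perms},
       monoid.mult = (\<lambda>a b. \<Sum>C\<in>Poly_Mapping.keys a. \<Sum>D\<in>Poly_Mapping.keys b.
                 Poly_Mapping.map ((*) (Poly_Mapping.lookup a C * Poly_Mapping.lookup b D))
                   (class_mult cst C D)),
       one = basis (cyc_class cst (cyc [])),
       zero = 0,
       add = (+),
       module.smult = (\<lambda>r. Poly_Mapping.map ((*) r)) \<rparr>"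

definition algebra_iso ::
    "'r ring \<Rightarrow> ('r, 'a) module \<Rightarrow> ('r, 'b) module \<Rightarrow> ('a \<Rightarrow> 'b) set" where
  "algebra_iso R A B = {h \<in> ring_iso A B.
     \<forall>r\<in>carrier R. \<forall>a\<in>carrier A. h (r \<odot>\<^bsub>A\<^esub> a) = r \<odot>\<^bsub>B\<^esub> h a}"

section \<open>The cyclic peak set\<close>

text \<open>
  Positions are 1-based as usual, so the letter at position \<open>i\<close> is \<open>p ! (i - 1)\<close>; its
  cyclic neighbours are \<open>p ! ((i - 2) mod n)\<close>, written so as to avoid truncated subtraction,
  and \<open>p ! (i mod n)\<close>.
\<close>

definition cPk :: "nat list \<Rightarrow> nat set" where
  "cPk p = (let n = length p in
     {i \<in> {1..n}. p ! ((i + n - 2) mod n) < p ! (i - 1) \<and> p ! (i mod n) < p ! (i - 1)})"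

definition cPk_cyc :: "nat list set \<Rightarrow> nat set multiset" where
  "cPk_cyc c = image_mset cPk (mset_set c)"

definition cyclic_peak_sets :: "nat \<Rightarrow> nat set set" where
  "cyclic_peak_sets n = cPk ` {p \<in> perms. length p = n}"

definition cyc_shift :: "nat \<Rightarrow> nat \<Rightarrow> nat set \<Rightarrow> nat set" where
  "cyc_shift n i S = (\<lambda>s. (s + i - 1) mod n + 1) ` S"

section \<open>Peak quasisymmetric functions\<close>

text \<open>
  A power series in countably many variables is its coefficient function on monomials, and
  a monomial is the multiset of the indices of its variables.  The variables are indexed by
  \<open>nat\<close>, index \<open>i\<close> standing for the variable usually called \<open>x\<close> with subscript \<open>i + 1\<close>.
\<close>

type_synonym series = "nat multiset \<Rightarrow> rat"

definition series_one :: series where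
  "series_one M = of_bool (M = {#})"

definition series_algebra :: "(rat, series) module" where
  "series_algebra =
     \<lparr> carrier = UNIV,
       monoid.mult = (\<lambda>f g M. \<Sum>(A, B)\<in>{(A, B). A + B = M}. f A * g B),
       one = series_one,
       zero = (\<lambda>M. 0),
       add = (\<lambda>f g M. f M + g M),
       module.smult = (\<lambda>r f M. r * f M) \<rparr>"

definition fundamental :: "nat \<Rightarrow> nat set \<Rightarrow> series" where
  "fundamental n T M = of_nat (card {xs. length xs = n \<and> sorted xs \<and>
     (\<forall>j\<in>T. xs ! (j - 1) < xs ! j) \<and> mset xs = M})"

text \<open>Only meaningful when \<open>S\<close> is the peak set of a permutation of length \<open>n\<close>.\<close>

definition peak_fun :: "nat \<Rightarrow> nat set \<Rightarrow> series" where
  "peak_fun n S = (if n = 0 then series_one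
     else (\<lambda>M. 2 ^ (card S + 1) *
            (\<Sum>T | T \<subseteq> {1..<n} \<and> S \<subseteq> (T - Suc ` T) \<union> (Suc ` T - T). fundamental n T M)))"

definition cyc_peak_fun :: "nat \<Rightarrow> nat set \<Rightarrow> series" where
  "cyc_peak_fun n S = (if n = 0 then series_one
     else (\<lambda>M. \<Sum>i = 1..n. peak_fun n (cyc_shift n i S - {1, n}) M))"

definition cyc_peak_algebra :: "(rat, series) module" where
  "cyc_peak_algebra = series_algebra \<lparr> carrier :=
     {f. \<exists>G r. finite G \<and> G \<subseteq> {cyc_peak_fun n S | n S. S \<in> cyclic_peak_sets n} \<and>
               f = (\<lambda>M. \<Sum>g\<in>G. r g * g M)} \<rparr>"

section \<open>The product of basis elements\<close>

lemma cyc_permsD: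
  assumes "p \<in> perms" "q \<in> cyc p"
  shows "length q = length p" "set q = set p" "q \<in> perms"
proof -
  obtain k where "q = rotate k p"
    using assms(2) unfolding cyc_def by blast
  with assms(1) show "length q = length p" "set q = set p" "q \<in> perms"
    by (simp_all add: perms_def)
qed

lemma self_in_cyc: "p \<in> cyc p"
  unfolding cyc_def by (rule CollectI, rule exI[of _ 0]) simp

lemma cyc_length_cyc: "p \<in> perms \<Longrightarrow> cyc_length (cyc p) = length p"
  unfolding cyc_length_def
  using cyc_permsD(1) someI[of "\<lambda>q. q \<in> cyc p", OF self_in_cyc] by blast

lemma cSh_memD:
  assumes "p \<in> perms" "q \<in> perms" "t \<in> cSh (cyc p) (cyc q)"
  shows "t \<in> cyclic_perms" "cyc_length t = length p + length q"
proof -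
  obtain u p' q' where u: "t = cyc u" "p' \<in> cyc p" "q' \<in> cyc q" "u \<in> Sh p' q'"
    using assms(3) unfolding cSh_def by blast
  then have "u \<in> perms" "length u = length p + length q"
    using cyc_permsD(1)[OF assms(1) u(2)] cyc_permsD(1)[OF assms(2) u(3)]
    by (simp_all add: Sh_def)
  with u(1) show "t \<in> cyclic_perms" "cyc_length t = length p + length q"
    by (simp_all add: cyclic_perms_def cyc_length_cyc)
qed

lemma cyc_disjoint_cyc:
  assumes "p \<in> perms" "q \<in> perms"
  shows "cyc_disjoint (cyc p) (cyc q) \<longleftrightarrow> set p \<inter> set q = {}"
proof
  assume "cyc_disjoint (cyc p) (cyc q)"
  then show "set p \<inter> set q = {}"
    unfolding cyc_disjoint_def using self_in_cyc[of p] self_in_cyc[of q] by blast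
next
  assume "set p \<inter> set q = {}"
  then show "cyc_disjoint (cyc p) (cyc q)"
    unfolding cyc_disjoint_def
    using cyc_permsD(2)[OF assms(1)] cyc_permsD(2)[OF assms(2)] by simp
qed

lemma finite_cSh:
  assumes "p \<in> perms" "q \<in> perms" "set p \<inter> set q = {}"
  shows "finite (cSh (cyc p) (cyc q))"
proof -
  let ?T = "{t. set t \<subseteq> set p \<union> set q \<and> length t = length p + length q}"
  have "t \<in> ?T" if "t \<in> Sh p' q'" "p' \<in> cyc p" "q' \<in> cyc q" for t p' q'
  proof -
    have s: "set p' = set p" "set q' = set q" "length p' = length p" "length q' = length q"
      using cyc_permsD(1,2)[OF assms(1) that(2)] cyc_permsD(1,2)[OF assms(2) that(3)] by simp_all
    have t: "length t = length p + length q" "distinct t" "subseq p' t" "subseq q' t"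
      using that(1) s(3,4) unfolding Sh_def perms_def by simp_all
    have "set p' \<subseteq> set t" "set q' \<subseteq> set t"
      using t(3,4) by (force elim: list_emb_set)+
    then have sub: "set p \<union> set q \<subseteq> set t"
      using s by simp
    have "card (set p \<union> set q) = card (set t)"
      using assms t(1,2) unfolding perms_def by (simp add: card_Un_disjoint distinct_card)
    then have "set t = set p \<union> set q"
      using card_subset_eq[OF _ sub] by simp
    with t show ?thesis by simp
  qed
  then have "cSh (cyc p) (cyc q) \<subseteq> cyc ` ?T"
    unfolding cSh_def by blast
  then show ?thesis
    by (rule finite_subset) (simp add: finite_lists_length_eq)
qed

theorem cyc_algebra_basis_mult:
  assumes comp: "cyclic_shuffle_compatible cst"
    and pq: "p \<in> perms" "q \<in> perms" "set p \<inter> set q = {}"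
  shows "basis (cyc_class cst (cyc p)) \<otimes>\<^bsub>cyc_algebra cst\<^esub> basis (cyc_class cst (cyc q)) =
           (\<Sum>t\<in>cSh (cyc p) (cyc q). basis (cyc_class cst t))"
proof -
  let ?C = "cyc_class cst (cyc p)" and ?D = "cyc_class cst (cyc q)"
  let ?P = "\<lambda>(c, d). c \<in> ?C \<and> d \<in> ?D \<and> cyc_disjoint c d"
  have ex: "?P (cyc p, cyc q)"
    using pq by (simp add: cyc_class_def cyc_disjoint_cyc cyclic_perms_def)
  obtain c d where cd: "(SOME x. ?P x) = (c, d)" by fastforce
  have P: "c \<in> ?C" "d \<in> ?D" "cyc_disjoint c d"
    using someI[of ?P, OF ex] unfolding cd by auto
  obtain p' q' where p': "p' \<in> perms" "c = cyc p'" and q': "q' \<in> perms" "d = cyc q'"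
    using P unfolding cyc_class_def cyclic_perms_def by blast
  have len: "length p' = length p" "length q' = length q"
    using P p' q' pq by (simp_all add: cyc_class_def cyc_length_cyc)
  have "image_mset cst (mset_set (cSh c d)) = image_mset cst (mset_set (cSh (cyc p) (cyc q)))"
  proof -
    have "c \<in> cyclic_perms" "cst c = cst (cyc p)" "cyc_length c = cyc_length (cyc p)"
      "d \<in> cyclic_perms" "cst d = cst (cyc q)" "cyc_length d = cyc_length (cyc q)"
      "cyc p \<in> cyclic_perms" "cyc q \<in> cyclic_perms" "cyc_disjoint (cyc p) (cyc q)"
      using P ex by (simp_all add: cyc_class_def)
    with comp P(3) show ?thesis
      unfolding cyclic_shuffle_compatible_def by blast
  qed
  then have eq: "image_mset cst (mset_set (cSh (cyc p') (cyc q'))) =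
      image_mset cst (mset_set (cSh (cyc p) (cyc q)))"
    using p' q' by simp
  define g where "g s = basis {e \<in> cyclic_perms. cst e = s \<and> cyc_length e = length p + length q}"
    for s
  have sum: "(\<Sum>t\<in>cSh (cyc u) (cyc v). basis (cyc_class cst t)) =
      sum_mset (image_mset g (image_mset cst (mset_set (cSh (cyc u) (cyc v)))))"
    if "u \<in> perms" "v \<in> perms" "length u = length p" "length v = length q" for u v
  proof -
    have "(\<Sum>t\<in>cSh (cyc u) (cyc v). basis (cyc_class cst t)) =
        (\<Sum>t\<in>cSh (cyc u) (cyc v). g (cst t))"
      using that by (intro sum.cong) (simp_all add: g_def cyc_class_def cSh_memD(2))
    then show ?thesis
      by (simp add: sum_unfold_sum_mset image_mset.compositionality comp_def)
  qed
  have "class_mult cst ?C ?D = (\<Sum>t\<in>cSh c d. basis (cyc_class cst t))"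
    unfolding class_mult_def cd by simp
  also have "\<dots> = (\<Sum>t\<in>cSh (cyc p) (cyc q). basis (cyc_class cst t))"
    using sum[of p' q'] sum[of p q] p' q' pq len eq by simp
  finally have cm: "class_mult cst ?C ?D = (\<Sum>t\<in>cSh (cyc p) (cyc q). basis (cyc_class cst t))" .
  have "Poly_Mapping.map ((*) (1::rat)) x = x" for x :: "nat list set set \<Rightarrow>\<^sub>0 rat"
    by (rule poly_mapping_eqI) (simp add: Poly_Mapping.map.rep_eq when_def)
  then show ?thesis
    unfolding cyc_algebra_def using cm by simp
qed

end

theory Submission
  imports Defs "HOL-Library.Product_Lexorder"
begin

text \<open>
  The cyclic peak function of a cyclic permutation is the sum of the peak functions
  \<open>K\<^bsub>n, Pk q\<^esub>\<close> over its rotations \<open>q\<close>.  Two facts about these sums carry the theorem.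

  \<^emph>\<open>They multiply like cyclic shuffles.\<close>  After Stembridge, the coefficient of a monomial in
  \<open>K\<^bsub>n, Pk q\<^esub>\<close> counts enriched \<open>q\<close>-partitions.  Here such an object is a strictly increasing list of
  pairs of a natural number and a nonzero integer, ordered lexicographically: the natural numbers
  are the indices of the variables, and the absolute values of the integers spell \<open>q\<close>.  The list can be
  recovered from its set of entries.  Hence splitting the entries according to whether their letter
  belongs to \<open>p\<close> or to \<open>q\<close> is a bijection from lists spelling a shuffle to pairs of lists spelling its
  two restrictions.  The words whose restrictions are rotations of \<open>p\<close> and of \<open>q\<close> are exactly the members of
  the cyclic shuffles of \<open>[p]\<close> and \<open>[q]\<close>, and the product formula \<open>cyc_peak_fun_mult\<close> follows.

  \<^emph>\<open>They are linearly independent over distinct classes.\<close>  The coefficient of \<open>K\<^bsub>n, S\<^esub>\<close> at a monomial of degree \<open>n\<close>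
  whose sorted word has ascent set \<open>J\<close> is a power of two, independent of \<open>S\<close>, if \<open>S \<subseteq> J \<union> (J + 1)\<close>, and is
  zero otherwise (\<open>peak_fun_eq\<close>).  This triangularity makes the \<open>K\<^bsub>n, S\<^esub>\<close> independent, so a linear relation
  among cyclic peak functions becomes a shift-invariant function \<open>f\<close> on cyclic peak sets with
  \<open>f R + f (R \<union> {1}) + f (R \<union> {n}) = 0\<close> for all \<open>R \<subseteq> {2, \<dots>, n - 1}\<close>.  For \<open>n \<ge> 2\<close> cyclic peak sets
  are nonempty and have no two cyclically adjacent elements, and this forces \<open>f = 0\<close>
  (\<open>shift_invariant_vanishes\<close>).

  The rest is formal.  By independence, the linear map from the space of formal combinations of
  classes to power series is injective, and it turns the sum of the classes of all
  cyclic shuffles into a product that depends only on the two classes; comparing coefficients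
  gives shuffle-compatibility.  The image is the span of the cyclic peak functions, and the algebra laws on both
  sides are inherited from power series.
\<close>

section \<open>Cyclic peak sets under rotation\<close>

lemma Suc_mem_cPk:
  "Suc j \<in> cPk p \<longleftrightarrow> j < length p \<and> p ! ((j + (length p - 1)) mod length p) < p ! j
     \<and> p ! (Suc j mod length p) < p ! j"
proof (cases "j < length p")
  case True
  then have "Suc j + length p - 2 = j + (length p - 1)" by simp
  with True show ?thesis unfolding cPk_def Let_def by (simp add: less_Suc_eq_le)
qed (auto simp: cPk_def Let_def)

lemma cPk_subset: "cPk p \<subseteq> {1..length p}"
  by (auto simp: cPk_def Let_def)

lemma Suc_mem_cPk_rotate:
  assumes "j < length p"
  shows "Suc j \<in> cPk (rotate k p) \<longleftrightarrow> Suc ((k + j) mod length p) \<in> cPk p"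
proof -
  define n where "n = length p"
  have n: "0 < n" "j < n" using assms by (auto simp: n_def)
  have 1: "((k + j) mod n + (n - 1)) mod n = (k + (j + (n - 1)) mod n) mod n"
    by (simp add: mod_simps add.assoc)
  have 2: "Suc ((k + j) mod n) mod n = (k + Suc j mod n) mod n"
    by (simp add: mod_simps)
  show ?thesis
    unfolding Suc_mem_cPk using n 1 2 by (simp add: nth_rotate flip: n_def)
qed

lemma cyc_shift_add:
  assumes "0 < n" "S \<subseteq> {1..n}"
  shows "cyc_shift n i (cyc_shift n j S) = cyc_shift n (i + j) S"
proof -
  have "((s + j - 1) mod n + 1 + i - 1) mod n + 1 = (s + (i + j) - 1) mod n + 1" if "s \<in> S" for s
  proof -
    from that assms obtain s' where "s = Suc s'" by (cases s) auto
    then show ?thesis by (simp add: mod_simps ac_simps)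
  qed
  then show ?thesis unfolding cyc_shift_def image_image by (intro image_cong) auto
qed

lemma cyc_shift_self:
  assumes "S \<subseteq> {1..n}"
  shows "cyc_shift n n S = S"
proof -
  have "(s + n - 1) mod n + 1 = s" if "s \<in> S" for s
  proof -
    from that assms obtain s' where "s = Suc s'" "s' < n" by (cases s) auto
    then show ?thesis by simp
  qed
  then show ?thesis unfolding cyc_shift_def by force
qed

lemma cyc_shift_cancel:
  assumes "0 < n" "S \<subseteq> {1..n}" "i \<le> n"
  shows "cyc_shift n (n - i) (cyc_shift n i S) = S"
  using assms cyc_shift_add[of n S "n - i" i] cyc_shift_self[of S n] by simp

text \<open>
  Rotating to the left by \<open>n - i\<close> moves every letter \<open>i\<close> places to the right, cyclically.
\<close>

lemma cPk_rotate:
  assumes "p \<noteq> []" "i \<le> length p"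
  shows "cPk (rotate (length p - i) p) = cyc_shift (length p) i (cPk p)"
proof -
  define n where "n = length p"
  have n: "0 < n" "i \<le> n" using assms by (auto simp: n_def)
  have sub: "cPk p \<subseteq> {1..n}" "cPk (rotate (n - i) p) \<subseteq> {1..n}"
    using cPk_subset[of p] cPk_subset[of "rotate (n - i) p"] by (auto simp: n_def)
  have "cyc_shift n (n - i) (cPk (rotate (n - i) p)) = cPk p"
  proof (intro subset_antisym subsetI)
    fix x assume "x \<in> cyc_shift n (n - i) (cPk (rotate (n - i) p))"
    then obtain s where s: "s \<in> cPk (rotate (n - i) p)" "x = (s + (n - i) - 1) mod n + 1"
      unfolding cyc_shift_def by blast
    with sub obtain j where "s = Suc j" "j < n" by (cases s) auto
    with s Suc_mem_cPk_rotate[of j p "n - i"] show "x \<in> cPk p"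
      by (simp add: n_def add.commute)
  next
    fix x assume x: "x \<in> cPk p"
    with sub obtain l where l: "x = Suc l" "l < n" by (cases x) auto
    define j where "j = (l + i) mod n"
    have j: "j < n" "(n - i + j) mod n = l"
    proof -
      have "n - i + (l + i) = l + n" using n by simp
      then have "(n - i + j) mod n = (l + n) mod n" unfolding j_def by (metis mod_add_right_eq)
      then show "(n - i + j) mod n = l" using l by simp
    qed (simp add: j_def n)
    then have "Suc j \<in> cPk (rotate (n - i) p)"
      using Suc_mem_cPk_rotate[of j p "n - i"] x l by (simp add: n_def)
    moreover have "x = (Suc j + (n - i) - 1) mod n + 1" using l j by (simp add: add.commute)
    ultimately show "x \<in> cyc_shift n (n - i) (cPk (rotate (n - i) p))"
      unfolding cyc_shift_def by blast
  qed
  then have "cyc_shift n i (cPk p) = cPk (rotate (n - i) p)"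
    using cyc_shift_cancel[OF n(1) sub(2), of "n - i"] n by simp
  then show ?thesis by (simp add: n_def)
qed

lemma bij_betw_rotations:
  assumes "distinct p" "p \<noteq> []"
  shows "bij_betw (\<lambda>i. rotate (length p - i) p) {1..length p} (cyc p)"
proof -
  define n where "n = length p"
  have n: "0 < n" using assms by (simp add: n_def)
  have inj: "inj_on (\<lambda>k. rotate k p) {..<n}"
  proof (rule inj_onI)
    fix k l assume kl: "k \<in> {..<n}" "l \<in> {..<n}" "rotate k p = rotate l p"
    have "rotate k p ! 0 = p ! k" "rotate l p ! 0 = p ! l"
      using kl(1,2) n by (simp_all add: nth_rotate n_def)
    then have "p ! k = p ! l" using kl(3) by metis
    then show "k = l" using kl(1,2) assms(1) by (simp add: nth_eq_iff_index_eq n_def)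
  qed
  have "bij_betw (\<lambda>i. n - i) {1..n} {..<n}"
    by (rule bij_betwI[of _ _ _ "\<lambda>k. n - k"]) (use n in auto)
  moreover have "(\<lambda>k. rotate k p) ` {..<n} = cyc p"
  proof
    show "cyc p \<subseteq> (\<lambda>k. rotate k p) ` {..<n}"
    proof
      fix q assume "q \<in> cyc p"
      then obtain k where "q = rotate k p" by (auto simp: cyc_def)
      then have "q = rotate (k mod n) p" by (metis n_def rotate_conv_mod)
      then show "q \<in> (\<lambda>k. rotate k p) ` {..<n}" using n by auto
    qed
  qed (auto simp: cyc_def)
  ultimately show ?thesis
    using bij_betw_trans[of "\<lambda>i. n - i" "{1..n}" "{..<n}" "\<lambda>k. rotate k p" "cyc p"] inj
    by (simp add: bij_betw_def comp_def n_def)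
qed

lemma finite_cyc: "p \<in> perms \<Longrightarrow> finite (cyc p)"
proof (cases "p = []")
  case True
  then show ?thesis by (simp add: cyc_def)
next
  case False
  assume "p \<in> perms"
  then show ?thesis
    using bij_betw_finite[OF bij_betw_rotations[of p]] False by (simp add: perms_def)
qed

text \<open>
  Cyclic permutations are orbits, so two of them are equal or disjoint.
\<close>

lemma cyc_eq:
  assumes "q \<in> cyc p"
  shows "cyc q = cyc p"
proof -
  from assms obtain k where q: "q = rotate k p" by (auto simp: cyc_def)
  have "\<exists>l. rotate m p = rotate l q" for m
  proof (cases "p = []")
    case False
    define n where "n = length p"
    have "0 < n" using False by (simp add: n_def)
    have k: "(m + (n * k - k)) + k = m + n * k" using \<open>0 < n\<close> by (cases n) auto
    have "rotate (m + (n * k - k)) q = rotate (m + n * k) p"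
      unfolding q rotate_rotate k ..
    also have "\<dots> = rotate m p"
      using rotate_conv_mod[of "m + n * k" p] rotate_conv_mod[of m p] by (simp add: n_def)
    finally show ?thesis by metis
  qed (use q in auto)
  then show ?thesis unfolding cyc_def by (auto simp: q rotate_rotate)
qed

text \<open>
  The \<open>n\<close> rotations of a word without repeated letters are distinct, so each cyclic shift of its peak set
  is counted once.  In particular the length and the peak set of a single rotation determine the whole multiset.
\<close>

lemma cPk_cyc_cyc:
  assumes "p \<in> perms" "p \<noteq> []"
  shows "cPk_cyc (cyc p) =
    image_mset (\<lambda>i. cyc_shift (length p) i (cPk p)) (mset_set {1..length p})"
proof -
  have "mset_set (cyc p) = image_mset (\<lambda>i. rotate (length p - i) p) (mset_set {1..length p})"
    using bij_betw_rotations[of p] assms by (simp add: perms_def bij_betw_def image_mset_mset_set)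
  then show ?thesis
    unfolding cPk_cyc_def
    by (simp add: image_mset.compositionality comp_def, intro image_mset_cong)
      (use assms cPk_rotate in auto)
qed

lemma cPk_cyc_eq:
  assumes "p \<in> perms" "q \<in> perms" "length p = length q" "cPk p = cPk q"
  shows "cPk_cyc (cyc p) = cPk_cyc (cyc q)"
  using assms cPk_cyc_cyc[of p] cPk_cyc_cyc[of q] by (cases "p = []"; cases "q = []") auto

text \<open>
  This form of the cyclic peak function makes its invariance under rotation visible, and it also covers
  the empty word, whose only rotation is itself.
\<close>

lemma cyc_peak_fun_eq_sum:
  assumes "p \<in> perms" "length p = n"
  shows "cyc_peak_fun n (cPk p) M = (\<Sum>q\<in>cyc p. peak_fun n (cPk q - {1, n}) M)"
proof (cases "p = []")
  case True
  then show ?thesis using assms by (simp add: cyc_peak_fun_def peak_fun_def cyc_def)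
next
  case False
  have "(\<Sum>q\<in>cyc p. peak_fun n (cPk q - {1, n}) M)
    = (\<Sum>i=1..n. peak_fun n (cPk (rotate (n - i) p) - {1, n}) M)"
    using sum.reindex_bij_betw[OF bij_betw_rotations[of p],
        of "\<lambda>q. peak_fun n (cPk q - {1, n}) M"] False assms
    by (simp add: perms_def)
  also have "\<dots> = cyc_peak_fun n (cPk p) M"
    using False assms cPk_rotate[of p] by (auto simp: cyc_peak_fun_def intro!: sum.cong)
  finally show ?thesis ..
qed

lemma count_cPk_cyc: 
  assumes "p \<in> perms"
  shows "count (cPk_cyc (cyc p)) U = card {q \<in> cyc p. cPk q = U}"
proof -
  have "cPk -` {U} \<inter> cyc p = {q \<in> cyc p. cPk q = U}" by auto
  then show ?thesis
    using finite_cyc[OF assms] by (simp add: cPk_cyc_def count_image_mset)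
qed

lemma count_cPk_cyc_shift:
  assumes "p \<in> perms" "p \<noteq> []" "U \<subseteq> {1..length p}" "i \<le> length p"
  shows "count (cPk_cyc (cyc p)) (cyc_shift (length p) i U) = count (cPk_cyc (cyc p)) U"
proof -
  define n where "n = length p"
  have le: "count (cPk_cyc (cyc p)) V \<le> count (cPk_cyc (cyc p)) (cyc_shift n j V)"
    if "j \<le> n" for V j
  proof -
    have m: "rotate (n - j) q \<in> {q \<in> cyc p. cPk q = cyc_shift n j V}"
      if "q \<in> {q \<in> cyc p. cPk q = V}" for q
    proof -
      have "q \<in> cyc p" "length q = n" "q \<noteq> []"
        using that cyc_permsD(1)[OF assms(1), of q] assms(2) by (auto simp: n_def)
      then have "rotate (n - j) q \<in> cyc p"
        using cyc_eq[of q p] by (auto simp: cyc_def)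
      with \<open>length q = n\<close> \<open>q \<noteq> []\<close> \<open>j \<le> n\<close> that cPk_rotate[of q j] show ?thesis by simp
    qed
    have "inj_on (rotate (n - j)) {q \<in> cyc p. cPk q = V}"
      using inj_fn[OF inj_rotate1, of "n - j"] by (auto simp: rotate_def intro: inj_on_subset)
    from card_inj_on_le[OF this _ ] m finite_cyc[OF assms(1)] show ?thesis
      unfolding count_cPk_cyc[OF assms(1)] by (simp add: image_subset_iff)
  qed
  have "cyc_shift n (n - i) (cyc_shift n i U) = U"
    using assms by (intro cyc_shift_cancel) (auto simp: n_def)
  with le[of i U] le[of "n - i" "cyc_shift n i U"] assms(4) show ?thesis
    by (simp add: n_def)
qed

lemma standardize_less_iff:
  assumes "i < length p" "j < length p"
  shows "standardize p ! i < standardize p ! j \<longleftrightarrow> p ! i < p ! j"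
proof
  assume "p ! i < p ! j"
  then have "{y \<in> set p. y \<le> p ! i} \<subset> {y \<in> set p. y \<le> p ! j}"
    using assms by (force simp: psubset_eq set_eq_iff intro: nth_mem)
  then show "standardize p ! i < standardize p ! j"
    using assms by (simp add: standardize_def psubset_card_mono)
next
  assume a: "standardize p ! i < standardize p ! j"
  show "p ! i < p ! j"
  proof (rule ccontr)
    assume "\<not> p ! i < p ! j"
    then have "{y \<in> set p. y \<le> p ! j} \<subseteq> {y \<in> set p. y \<le> p ! i}" by auto
    with a assms show False by (simp add: standardize_def card_mono leD)
  qed
qed

lemma cPk_cong:
  assumes "length p = length q"
    and "\<And>i j. i < length p \<Longrightarrow> j < length p \<Longrightarrow> p ! i < p ! j \<longleftrightarrow> q ! i < q ! j"
  shows "cPk p = cPk q"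
proof -
  have "Suc j \<in> cPk p \<longleftrightarrow> Suc j \<in> cPk q" for j
  proof (cases "j < length p")
    case True
    then have "(j + (length p - 1)) mod length p < length p" "Suc j mod length p < length p"
      by (auto intro!: mod_less_divisor)
    with True assms show ?thesis unfolding Suc_mem_cPk by (metis assms(1))
  qed (simp add: Suc_mem_cPk assms(1))
  moreover have "0 \<notin> cPk p" "0 \<notin> cPk q" by (auto simp: cPk_def Let_def)
  ultimately show ?thesis by (metis not0_implies_Suc subset_antisym subsetI)
qed

lemma cyclic_statistic_cPk_cyc: "cyclic_statistic cPk_cyc"
  unfolding cyclic_statistic_def
proof (intro ballI impI)
  fix p q assume p: "p \<in> perms" "q \<in> perms" and eq: "standardize p = standardize q"
  have len: "length p = length q" using arg_cong[OF eq, of length] by (simp add: standardize_def)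
  moreover have "cPk p = cPk q"
    by (rule cPk_cong[OF len]) (metis eq len standardize_less_iff)
  ultimately show "cPk_cyc (cyc p) = cPk_cyc (cyc q)" using p cPk_cyc_eq by blast
qed

text \<open>
  The map \<open>x \<mapsto> x mod n + 1\<close> is the cyclic successor on \<open>{1..n}\<close>; two cyclically adjacent positions
  cannot both be peaks.
\<close>

definition cyc_sparse :: "nat \<Rightarrow> nat set \<Rightarrow> bool" where
  "cyc_sparse n U \<longleftrightarrow> (\<forall>x\<in>U. x mod n + 1 \<notin> U)"

lemma cyc_sparse_cPk: "cyc_sparse (length p) (cPk p)"
  unfolding cyc_sparse_def
proof
  fix x assume x: "x \<in> cPk p"
  define n where "n = length p"
  from x cPk_subset[of p] obtain j where j: "x = Suc j" "j < n" by (cases x) (auto simp: n_def)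
  have "(Suc j mod n + (n - 1)) mod n = (Suc j + (n - 1)) mod n"
    by (rule mod_add_left_eq)
  also have "\<dots> = (j + n) mod n" using j by simp
  finally have "(Suc j mod n + (n - 1)) mod n = j"
    using j by simp
  then show "x mod length p + 1 \<notin> cPk p"
    using x j by (auto simp: Suc_mem_cPk n_def)
qed

text \<open>
  The largest letter is a cyclic peak as soon as it has a neighbour other than itself.
\<close>

lemma cPk_nonempty:
  assumes "p \<in> perms" "2 \<le> length p"
  shows "cPk p \<noteq> {}"
proof -
  define n where "n = length p"
  have "Max (set p) \<in> set p" using assms by (intro Max_in) auto
  then obtain j where j: "j < n" "p ! j = Max (set p)" by (auto simp: in_set_conv_nth n_def)
  have less: "p ! i < p ! j" if "i < n" "i \<noteq> j" for i
  proof -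
    have "p ! i \<le> p ! j" using that j by (simp add: n_def)
    moreover have "p ! i \<noteq> p ! j"
      using that j(1) assms nth_eq_iff_index_eq[of p i j] by (simp add: perms_def n_def)
    ultimately show ?thesis by simp
  qed
  have n: "2 \<le> n" using assms by (simp add: n_def)
  have "(j + (n - 1)) mod n \<noteq> j"
  proof (cases j)
    case (Suc l)
    then have "j + (n - 1) = l + n" using n by simp
    then show ?thesis using Suc j by simp
  qed (use n in simp)
  moreover have "Suc j mod n \<noteq> j" using n j by (simp add: mod_Suc)
  ultimately have "Suc j \<in> cPk p"
    unfolding Suc_mem_cPk using less j n by (simp flip: n_def)
  then show ?thesis by blast
qed

section \<open>Coefficients of the peak quasisymmetric functions\<close>

text \<open>
  These are the positions at which the weakly increasing word with content \<open>M\<close> strictly increases.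
\<close>

definition ascents :: "nat multiset \<Rightarrow> nat set" where
  "ascents M = {j \<in> {1..<size M}.
     sorted_list_of_multiset M ! (j - 1) < sorted_list_of_multiset M ! j}"

lemma ascents_subset: "ascents M \<subseteq> {1..<size M}"
  by (auto simp: ascents_def)

lemma finite_ascents: "finite (ascents M)"
  by (rule finite_subset[OF ascents_subset]) simp

text \<open>
  A monomial arises from only one weakly increasing word, so the coefficients of a fundamental
  quasisymmetric function are \<open>0\<close> or \<open>1\<close>.
\<close>

lemma fundamental_eq:
  assumes "T \<subseteq> {1..<n}"
  shows "fundamental n T M = of_bool (size M = n \<and> T \<subseteq> ascents M)"
proof -
  define v where "v = sorted_list_of_multiset M"
  have v: "mset v = M" "sorted v" "length v = size M"
    unfolding v_def by (simp_all flip: size_mset)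
  have asc: "T \<subseteq> ascents M \<longleftrightarrow> (\<forall>j\<in>T. v ! (j - 1) < v ! j)" if "size M = n"
    using assms that by (auto simp: ascents_def v_def)
  have "{xs. length xs = n \<and> sorted xs \<and> (\<forall>j\<in>T. xs ! (j - 1) < xs ! j) \<and> mset xs = M}
      = (if size M = n \<and> T \<subseteq> ascents M then {v} else {})"
  proof (rule Set.set_eqI)
    fix xs
    have "length xs = n \<and> sorted xs \<and> mset xs = M \<longleftrightarrow> xs = v \<and> size M = n"
      using v by (metis size_mset properties_for_sort)
    then show "xs \<in> {xs. length xs = n \<and> sorted xs \<and> (\<forall>j\<in>T. xs ! (j - 1) < xs ! j) \<and> mset xs = M}
      \<longleftrightarrow> xs \<in> (if size M = n \<and> T \<subseteq> ascents M then {v} else {})"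
      using asc by auto
  qed
  then show ?thesis by (simp add: fundamental_def)
qed

text \<open>
  The pairs \<open>{s - 1, s}\<close> with \<open>s \<in> S\<close> are disjoint, so a set \<open>T\<close> is chosen independently on each pair and on
  the rest of \<open>J\<close>.  If \<open>J\<close> contains both members of a pair, then \<open>2\<close> of the \<open>4\<close> choices are admissible; if
  it contains one, then \<open>1\<close> of \<open>2\<close>; if none, then no choice is.  So each pair halves the number \<open>2 ^ card J\<close> of all
  subsets, unless some pair misses \<open>J\<close>.
\<close>

lemma card_exactly_one_pairs:
  assumes "finite S" "\<And>s. s \<in> S \<Longrightarrow> Suc s \<notin> S" "0 \<notin> S" "finite J"
  shows "2 ^ card S * card {T. T \<subseteq> J \<and> (\<forall>s\<in>S. (s \<in> T) \<noteq> (s - 1 \<in> T))}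
       = of_bool (\<forall>s\<in>S. s \<in> J \<or> s - 1 \<in> J) * (2::nat) ^ card J"
  using assms
proof (induction S arbitrary: J rule: finite_induct)
  case empty
  then show ?case using card_Pow[of J] by (simp add: Pow_def)
next
  case (insert s S)
  define J' where "J' = J - {s - 1, s}"
  define N where "N J S = {T. T \<subseteq> J \<and> (\<forall>s\<in>S. (s \<in> T) \<noteq> (s - 1 \<in> T))}" for J S :: "nat set"
  define A where "A = {U. U \<subseteq> J \<inter> {s - 1, s} \<and> (s \<in> U) \<noteq> (s - 1 \<in> U)}"
  have s: "0 < s" "s - 1 \<noteq> s" using insert.prems by auto
  have far: "s' \<notin> {s - 1, s}" "s' - 1 \<notin> {s - 1, s}" if "s' \<in> S" for s'
    using that insert.prems(1)[of s] insert.prems(1)[of s'] insert.prems(2) insert.hyps(2)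
    by (cases s; cases s'; auto)+
  \<comment> \<open>The conditions from the remaining pairs only see the part of \<open>T\<close> outside \<open>{s - 1, s}\<close>.\<close>
  have "bij_betw (\<lambda>T. (T \<inter> {s - 1, s}, T \<inter> J')) (N J (insert s S)) (A \<times> N J' S)"
  proof (rule bij_betwI[of _ _ _ "\<lambda>(U, T). U \<union> T"])
    show "(\<lambda>T. (T \<inter> {s - 1, s}, T \<inter> J')) \<in> N J (insert s S) \<rightarrow> A \<times> N J' S"
    proof
      fix T assume T: "T \<in> N J (insert s S)"
      then have "T \<inter> {s - 1, s} \<in> A" unfolding N_def A_def by blast
      moreover have "s' \<in> T \<inter> J' \<longleftrightarrow> s' \<in> T" "s' - 1 \<in> T \<inter> J' \<longleftrightarrow> s' - 1 \<in> T" if "s' \<in> S" for s'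
        using T far[OF that] unfolding N_def J'_def by blast+
      then have "T \<inter> J' \<in> N J' S" using T unfolding N_def by blast
      ultimately show "(T \<inter> {s - 1, s}, T \<inter> J') \<in> A \<times> N J' S" by blast
    qed
    show "(\<lambda>(U, T). U \<union> T) \<in> A \<times> N J' S \<rightarrow> N J (insert s S)"
    proof (intro funcsetI, clarify)
      fix U T assume UT: "U \<in> A" "T \<in> N J' S"
      have "s' \<in> U \<union> T \<longleftrightarrow> s' \<in> T" "s' - 1 \<in> U \<union> T \<longleftrightarrow> s' - 1 \<in> T" if "s' \<in> S" for s'
        using UT far[OF that] unfolding A_def by blast+
      moreover have "s \<in> U \<union> T \<longleftrightarrow> s \<in> U" "s - 1 \<in> U \<union> T \<longleftrightarrow> s - 1 \<in> U" "U \<union> T \<subseteq> J"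
        using UT unfolding N_def A_def J'_def by blast+
      ultimately show "U \<union> T \<in> N J (insert s S)"
        using UT unfolding N_def A_def by blast
    qed
    show "(case (T \<inter> {s - 1, s}, T \<inter> J') of (U, T) \<Rightarrow> U \<union> T) = T" if "T \<in> N J (insert s S)" for T
      using that unfolding N_def J'_def by blast
    show "(\<lambda>T. (T \<inter> {s - 1, s}, T \<inter> J')) (case y of (U, T) \<Rightarrow> U \<union> T) = y"
      if y': "y \<in> A \<times> N J' S" for y
    proof -
      obtain U T where y: "y = (U, T)" "U \<in> A" "T \<in> N J' S" using y' by auto
      then have "(U \<union> T) \<inter> {s - 1, s} = U" "(U \<union> T) \<inter> J' = T"
        unfolding N_def A_def J'_def by blast+
      then show ?thesis by (simp add: y(1))
    qed
  qed
  then have N: "card (N J (insert s S)) = card A * card (N J' S)"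
    by (simp add: bij_betw_same_card card_cartesian_product)
  have A: "A = (if s \<in> J then {{s}} else {}) \<union> (if s - 1 \<in> J then {{s - 1}} else {})"
  proof (intro subset_antisym subsetI)
    fix U assume U: "U \<in> A"
    then have "U = {s} \<and> s \<in> J \<or> U = {s - 1} \<and> s - 1 \<in> J" unfolding A_def by blast
    then show "U \<in> (if s \<in> J then {{s}} else {}) \<union> (if s - 1 \<in> J then {{s - 1}} else {})" by auto
  next
    fix U assume "U \<in> (if s \<in> J then {{s}} else {}) \<union> (if s - 1 \<in> J then {{s - 1}} else {})"
    then have "U = {s} \<and> s \<in> J \<or> U = {s - 1} \<and> s - 1 \<in> J" by (auto split: if_splits)
    then show "U \<in> A" using s(2) unfolding A_def by auto
  qed
  have cA: "2 * card A = of_bool (s \<in> J \<or> s - 1 \<in> J) * 2 ^ card (J \<inter> {s - 1, s})"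
  proof -
    consider "s \<in> J" "s - 1 \<in> J" | "s \<in> J" "s - 1 \<notin> J" | "s \<notin> J" "s - 1 \<in> J"
      | "s \<notin> J" "s - 1 \<notin> J" by blast
    then show ?thesis
    proof cases
      case 1
      then have "J \<inter> {s - 1, s} = {s - 1, s}" by auto
      with 1 s show ?thesis by (simp add: A)
    next
      case 2
      then have "J \<inter> {s - 1, s} = {s}" by auto
      with 2 show ?thesis by (simp add: A)
    next
      case 3
      then have "J \<inter> {s - 1, s} = {s - 1}" by auto
      with 3 show ?thesis by (simp add: A)
    qed (simp add: A)
  qed
  have IH: "2 ^ card S * card (N J' S) = of_bool (\<forall>s\<in>S. s \<in> J' \<or> s - 1 \<in> J') * (2::nat) ^ card J'"
    using insert.IH[of J'] insert.prems unfolding N_def by (simp add: J'_def)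
  have J': "(\<forall>s\<in>S. s \<in> J' \<or> s - 1 \<in> J') \<longleftrightarrow> (\<forall>s\<in>S. s \<in> J \<or> s - 1 \<in> J)"
    using far unfolding J'_def by blast
  have "card J = card (J \<inter> {s - 1, s}) + card J'"
    unfolding J'_def using insert.prems(3)
    by (subst card_Un_disjoint[symmetric]) (auto intro: arg_cong[of _ _ card])
  then have "of_bool (\<forall>s\<in>insert s S. s \<in> J \<or> s - 1 \<in> J) * (2::nat) ^ card J
    = (of_bool (s \<in> J \<or> s - 1 \<in> J) * 2 ^ card (J \<inter> {s - 1, s}))
      * (of_bool (\<forall>s\<in>S. s \<in> J \<or> s - 1 \<in> J) * 2 ^ card J')"
    by (simp add: power_add of_bool_conj)
  also have "\<dots> = (2 * card A) * (2 ^ card S * card (N J' S))" using cA IH J' by simp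
  also have "\<dots> = 2 ^ card (insert s S) * card (N J (insert s S))"
    using insert.hyps by (simp add: N)
  finally show ?case by (simp add: N_def)
qed

lemma card_set_sorted:
  fixes v :: "nat list"
  assumes "sorted v" "v \<noteq> []"
  shows "card (set v) = Suc (card {j \<in> {1..<length v}. v ! (j - 1) < v ! j})"
  using assms
proof (induction v rule: induct_list012)
  case (3 a b v)
  let ?D = "\<lambda>v. {j \<in> {1..<length v}. v ! (j - 1) < v ! j}"
  have "j \<in> ?D (a # b # v) \<longleftrightarrow> j \<in> (if a < b then {1} else {}) \<union> Suc ` ?D (b # v)" for j
    by (cases j; cases "j - 1") (auto simp: less_Suc_eq_0_disj)
  then have D: "?D (a # b # v) = (if a < b then {1} else {}) \<union> Suc ` ?D (b # v)" by blast
  have "card (?D (a # b # v)) = of_bool (a < b) + card (?D (b # v))"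
    unfolding D by (subst card_Un_disjoint) (auto simp: card_image)
  moreover have "card (set (a # b # v)) = of_bool (a < b) + card (set (b # v))"
  proof (cases "a < b")
    case True
    then have "a \<notin> set (b # v)" using 3 by auto
    then show ?thesis using True by (simp only: list.set(2)[of a]) simp
  next
    case False
    then have "a = b" using 3 by auto
    then show ?thesis by simp
  qed
  ultimately show ?case using 3 by simp
qed auto

lemma card_set_mset_ascents: "M \<noteq> {#} \<Longrightarrow> card (set_mset M) = Suc (card (ascents M))"
proof -
  define v where "v = sorted_list_of_multiset M"
  assume "M \<noteq> {#}"
  moreover have v: "mset v = M" "sorted v" "length v = size M" "set v = set_mset M"
    unfolding v_def by (simp_all flip: size_mset)
  ultimately show ?thesis
    using card_set_sorted[of v] unfolding ascents_def by (auto simp flip: v_def)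
qed

text \<open>
  The factor \<open>2 ^ card S\<close> in the definition compensates the halvings counted in \<open>card_exactly_one_pairs\<close>, so apart
  from the condition on \<open>S\<close> the value depends on the monomial alone.
\<close>

lemma peak_fun_eq:
  assumes "0 < n" "S \<subseteq> {2..<n}" "\<And>s. s \<in> S \<Longrightarrow> Suc s \<notin> S"
  shows "peak_fun n S M =
    of_bool (size M = n \<and> S \<subseteq> ascents M \<union> Suc ` ascents M) * 2 ^ card (set_mset M)"
proof -
  define J where "J = ascents M"
  have pred: "s - 1 \<in> U \<longleftrightarrow> s \<in> Suc ` U" if "s \<in> S" for s U
    using that assms(2) by (cases s) auto
  have "(\<Sum>T | T \<subseteq> {1..<n} \<and> S \<subseteq> (T - Suc ` T) \<union> (Suc ` T - T). fundamental n T M)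
     = (\<Sum>T | T \<subseteq> {1..<n} \<and> S \<subseteq> (T - Suc ` T) \<union> (Suc ` T - T). of_bool (size M = n \<and> T \<subseteq> J))"
    by (intro sum.cong) (auto simp: fundamental_eq J_def)
  also have "\<dots> = of_nat (card {T. T \<subseteq> {1..<n} \<and> S \<subseteq> (T - Suc ` T) \<union> (Suc ` T - T) \<and> size M = n \<and> T \<subseteq> J})"
    by (simp add: sum_of_bool_eq conj_assoc Int_def)
  also have "{T. T \<subseteq> {1..<n} \<and> S \<subseteq> (T - Suc ` T) \<union> (Suc ` T - T) \<and> size M = n \<and> T \<subseteq> J}
    = (if size M = n then {T. T \<subseteq> J \<and> (\<forall>s\<in>S. (s \<in> T) \<noteq> (s - 1 \<in> T))} else {})"
    using pred ascents_subset[of M] by (auto simp: J_def)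
  finally have *: "(\<Sum>T | T \<subseteq> {1..<n} \<and> S \<subseteq> (T - Suc ` T) \<union> (Suc ` T - T). fundamental n T M)
    = (if size M = n then of_nat (card {T. T \<subseteq> J \<and> (\<forall>s\<in>S. (s \<in> T) \<noteq> (s - 1 \<in> T))}) else 0)"
    by simp
  have "finite S" using assms(2) finite_subset by blast
  then have "2 ^ card S * card {T. T \<subseteq> J \<and> (\<forall>s\<in>S. (s \<in> T) \<noteq> (s - 1 \<in> T))}
       = of_bool (\<forall>s\<in>S. s \<in> J \<or> s - 1 \<in> J) * (2::nat) ^ card J"
    using assms finite_ascents[of M] by (intro card_exactly_one_pairs) (auto simp: J_def)
  also have "(\<forall>s\<in>S. s \<in> J \<or> s - 1 \<in> J) \<longleftrightarrow> S \<subseteq> J \<union> Suc ` J" using pred by auto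
  finally have "(2::rat) ^ card S * of_nat (card {T. T \<subseteq> J \<and> (\<forall>s\<in>S. (s \<in> T) \<noteq> (s - 1 \<in> T))})
       = of_bool (S \<subseteq> J \<union> Suc ` J) * 2 ^ card J"
    by (metis (mono_tags, lifting) of_nat_mult of_nat_numeral of_nat_of_bool of_nat_power)
  moreover have "card (set_mset M) = Suc (card J)" if "size M = n"
    using that assms(1) card_set_mset_ascents[of M] nonempty_has_size[of M] by (simp add: J_def)
  moreover have "peak_fun n S M = 2 ^ (card S + 1) *
      (\<Sum>T | T \<subseteq> {1..<n} \<and> S \<subseteq> (T - Suc ` T) \<union> (Suc ` T - T). fundamental n T M)"
    using assms(1) by (simp add: peak_fun_def)
  ultimately show ?thesis
    unfolding * by (auto simp: J_def)
qed

section \<open>Enriched partitions\<close>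

text \<open>
  An enriched \<open>q\<close>-partition assigns to each letter of \<open>q\<close> an index with a sign.  The sign is carried by the
  letter, as in a signed permutation: an entry with index \<open>v\<close> and letter \<open>x\<close> is the pair \<open>(v, x)\<close> or \<open>(v, -x)\<close>.
  Among entries with equal index, the increasing order of the integers puts the negative entries first, with
  decreasing letters, and then the positive ones, with increasing letters, which is exactly Stembridge's condition.
\<close>

abbreviation letter :: "nat \<times> int \<Rightarrow> nat" where
  "letter w \<equiv> nat \<bar>snd w\<bar>"

text \<open>
  The ways to sign the letters of \<open>q\<close> when the weakly increasing list \<open>vs\<close> of indices is prescribed.
\<close>

definition signings :: "nat list \<Rightarrow> nat list \<Rightarrow> int list set" where
  "signings vs q = {zs. map (\<lambda>z. nat \<bar>z\<bar>) zs = q \<and> sorted_wrt (<) (zip vs zs)}"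

text \<open>
  Within a block of equal indices the letters of an enriched partition first decrease and then increase.  A block
  can therefore be signed if and only if it contains no peak together with both neighbours of the peak.
\<close>

fun level_descent :: "nat list \<Rightarrow> nat list \<Rightarrow> bool" where
  "level_descent (u # v # vs) (x # y # q) \<longleftrightarrow> u = v \<and> y < x"
| "level_descent vs q \<longleftrightarrow> False"

fun no_level_peak :: "nat list \<Rightarrow> nat list \<Rightarrow> bool" where
  "no_level_peak (u # v # vs) (x # y # q) \<longleftrightarrow>
     \<not> (u = v \<and> x < y \<and> level_descent (v # vs) (y # q)) \<and> no_level_peak (v # vs) (y # q)"
| "no_level_peak vs q \<longleftrightarrow> True"

lemma no_level_peak_iff:
  "length vs = length q \<Longrightarrow> no_level_peak vs q \<longleftrightarrow>
    (\<forall>i. i + 2 < length q \<longrightarrow> q ! i < q ! (i + 1) \<longrightarrow> q ! (i + 2) < q ! (i + 1) \<longrightarrow>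
       \<not> (vs ! i = vs ! (i + 1) \<and> vs ! (i + 1) = vs ! (i + 2)))"
proof (induction vs q rule: no_level_peak.induct)
  case (1 u v vs x y q)
  have split: "(\<forall>i. P i) \<longleftrightarrow> P 0 \<and> (\<forall>i. P (Suc i))" for P :: "nat \<Rightarrow> bool"
    by (metis not0_implies_Suc)
  have "level_descent (v # vs) (y # q) \<longleftrightarrow> 0 < length q \<and> v = vs ! 0 \<and> q ! 0 < y"
    using 1(2) by (cases vs; cases q) auto
  then show ?case
    using 1 by (subst split) auto
qed (auto simp: less_Suc_eq)

lemma finite_signings: "finite (signings vs q)"
proof (rule finite_subset)
  show "signings vs q \<subseteq> {zs. set zs \<subseteq> int ` set q \<union> (\<lambda>x. - int x) ` set q \<and> length zs = length q}"
  proof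
    fix zs assume "zs \<in> signings vs q"
    then have q: "q = map (\<lambda>z. nat \<bar>z\<bar>) zs" by (simp add: signings_def)
    have "z \<in> int ` nat ` abs ` set zs \<union> (\<lambda>x. - int x) ` nat ` abs ` set zs" if "z \<in> set zs" for z
    proof (cases "0 \<le> z")
      case True
      then have "z = int (nat \<bar>z\<bar>)" by simp
      with that show ?thesis by blast
    next
      case False
      then have "z = - int (nat \<bar>z\<bar>)" by simp
      with that show ?thesis by blast
    qed
    then show "zs \<in> {zs. set zs \<subseteq> int ` set q \<union> (\<lambda>x. - int x) ` set q \<and> length zs = length q}"
      unfolding q by (auto simp: image_image)
  qed
qed (simp add: finite_lists_length_eq)

lemma Cons_mem_signings:
  assumes "u \<le> v"
  shows "z # zs \<in> signings (u # v # vs) (x # y # q) \<longleftrightarrow>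
     nat \<bar>z\<bar> = x \<and> zs \<in> signings (v # vs) (y # q) \<and> (u < v \<or> z < hd zs)"
  using assms by (cases zs) (auto simp: signings_def sorted_wrt2 simp del: sorted_wrt.simps(2))

text \<open>
  In a block whose letters decrease and then increase, every sign is forced except that of the smallest letter, so each block
  contributes a factor \<open>2\<close>.  The induction adds entries in front; it must also keep track of the signings that
  start with a positive entry, because only these can be extended by a smaller letter with the same index.
  They are all impossible if the first block starts with a descent, and are half of all signings otherwise.
\<close>

lemma card_signings:
  assumes "sorted vs" "length vs = length q" "q \<noteq> []" "distinct q" "0 \<notin> set q"
  shows "card (signings vs q) = of_bool (no_level_peak vs q) * 2 ^ card (set vs)"
    and "2 * card {zs \<in> signings vs q. 0 < hd zs} =
      of_bool (no_level_peak vs q \<and> \<not> level_descent vs q) * 2 ^ card (set vs)"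
proof -
  have single: "card (signings [v] [x]) = 2" "card {zs \<in> signings [v] [x]. 0 < hd zs} = 1"
    if "0 < x" for v x
  proof -
    have "zs \<in> signings [v] [x] \<longleftrightarrow> zs \<in> {[int x], [- int x]}" for zs
      using that by (cases zs) (auto simp: signings_def)
    then have eq: "signings [v] [x] = {[int x], [- int x]}" by blast
    have "{zs \<in> signings [v] [x]. 0 < hd zs} = {[int x]}" unfolding eq using that by auto
    then show "card (signings [v] [x]) = 2" "card {zs \<in> signings [v] [x]. 0 < hd zs} = 1"
      using that unfolding eq by simp_all
  qed
  have "card (signings vs q) = of_bool (no_level_peak vs q) * 2 ^ card (set vs) \<and>
    2 * card {zs \<in> signings vs q. 0 < hd zs} =
      of_bool (no_level_peak vs q \<and> \<not> level_descent vs q) * 2 ^ card (set vs)"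
    using assms
  proof (induction vs q rule: no_level_peak.induct)
    case (1 u v vs x y q)
    define L where "L = signings (v # vs) (y # q)"
    define P where "P = {zs \<in> L. 0 < hd zs}"
    define c where "c = card (set (v # vs))"
    have xy: "0 < x" "0 < y" "x \<noteq> y" and uv: "u \<le> v" using 1(2,5,6) by auto
    have IH: "card L = of_bool (no_level_peak (v # vs) (y # q)) * 2 ^ c"
      "2 * card P = of_bool (no_level_peak (v # vs) (y # q) \<and> \<not> level_descent (v # vs) (y # q)) * 2 ^ c"
      using 1 unfolding L_def P_def c_def by auto
    have hd: "hd zs = int y \<or> hd zs = - int y" if "zs \<in> L" for zs
      using that xy by (cases zs) (auto simp: L_def signings_def)
    \<comment> \<open>The signings of the shorter word that can follow the entry \<open>s\<close>.\<close>
    define A where "A s = {zs \<in> L. u < v \<or> s < hd zs}" for s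
    have part: "{zs \<in> signings (u # v # vs) (x # y # q). hd zs = s} = (\<lambda>zs. s # zs) ` A s"
      if "nat \<bar>s\<bar> = x" for s
    proof -
      have "zs \<in> {zs \<in> signings (u # v # vs) (x # y # q). hd zs = s} \<longleftrightarrow> zs \<in> (\<lambda>zs. s # zs) ` A s" for zs
        using that Cons_mem_signings[OF uv]
        by (cases zs) (auto simp: A_def L_def, simp add: signings_def)
      then show ?thesis by blast
    qed
    have hd': "hd zs = int x \<or> hd zs = - int x" if "zs \<in> signings (u # v # vs) (x # y # q)" for zs
      using that xy by (cases zs) (auto simp: signings_def)
    have "{zs \<in> signings (u # v # vs) (x # y # q). 0 < hd zs}
       = {zs \<in> signings (u # v # vs) (x # y # q). hd zs = int x}"
      using hd' xy by fastforce
    then have pos: "card {zs \<in> signings (u # v # vs) (x # y # q). 0 < hd zs} = card (A (int x))"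
      by (simp add: part card_image)
    have "signings (u # v # vs) (x # y # q)
       = {zs \<in> signings (u # v # vs) (x # y # q). hd zs = int x}
         \<union> {zs \<in> signings (u # v # vs) (x # y # q). hd zs = - int x}"
      using hd' by auto
    also have "\<dots> = (\<lambda>zs. int x # zs) ` A (int x) \<union> (\<lambda>zs. - int x # zs) ` A (- int x)"
      by (simp add: part)
    finally have "card (signings (u # v # vs) (x # y # q)) = card ((\<lambda>zs. int x # zs) ` A (int x) \<union> (\<lambda>zs. - int x # zs) ` A (- int x))"
      by simp
    also have "\<dots> = card (A (int x)) + card (A (- int x))"
      using xy finite_signings[of "v # vs" "y # q"]
      by (subst card_Un_disjoint) (auto simp: card_image A_def L_def)
    finally have all: "card (signings (u # v # vs) (x # y # q)) = card (A (int x)) + card (A (- int x))" .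
    consider "u < v" | "u = v" "y < x" | "u = v" "x < y" using uv xy by linarith
    then show ?case
    proof cases
      case 1
      then have "u \<notin> set (v # vs)" using \<open>sorted (u # v # vs)\<close> by auto
      then have "card (set (u # v # vs)) = Suc c" by (simp only: list.set(2)[of u] c_def) simp
      moreover have "A s = L" for s using 1 by (simp add: A_def)
      ultimately show ?thesis using IH 1 unfolding all pos by simp
    next
      case 2
      have "A (int x) = {}" using 2 hd by (fastforce simp: A_def)
      moreover have "A (- int x) = L" using 2 hd by (fastforce simp: A_def)
      ultimately show ?thesis using IH 2 unfolding all pos by (simp add: c_def)
    next
      case 3
      have "A (int x) = P" using 3 hd by (fastforce simp: A_def P_def)
      moreover have "A (- int x) = P" using 3 xy hd by (fastforce simp: A_def P_def)
      ultimately show ?thesis using IH 3 unfolding all pos by (auto simp: c_def)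
    qed
  next
    case ("2_2" v q)
    then obtain x where "q = [x]" by (cases q) auto
    then show ?case using "2_2" by (simp add: single)
  next
    case ("2_4" vs x)
    then obtain v where "vs = [v]" by (cases vs) auto
    then show ?case using "2_4" by (simp add: single)
  qed auto
  then show "card (signings vs q) = of_bool (no_level_peak vs q) * 2 ^ card (set vs)"
    and "2 * card {zs \<in> signings vs q. 0 < hd zs} =
      of_bool (no_level_peak vs q \<and> \<not> level_descent vs q) * 2 ^ card (set vs)"
    by blast+
qed

text \<open>
  Allowing a set of underlying words lets one treat all rotations of a word, or all cyclic shuffles, at once.
\<close>

definition enriched :: "nat list set \<Rightarrow> nat multiset \<Rightarrow> (nat \<times> int) list set" where
  "enriched Q M = {ws. sorted_wrt (<) ws \<and> map letter ws \<in> Q \<and> mset (map fst ws) = M}"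

lemma bij_betw_signings_enriched:
  assumes "size M = length q"
  shows "bij_betw (zip (sorted_list_of_multiset M)) (signings (sorted_list_of_multiset M) q) (enriched {q} M)"
proof -
  define v where "v = sorted_list_of_multiset M"
  have v: "mset v = M" "sorted v" "length v = length q"
    using assms unfolding v_def by (simp_all flip: size_mset)
  have fst_sorted: "map fst ws = v" if "sorted_wrt (<) ws" "mset (map fst ws) = M" for ws :: "(nat \<times> int) list"
  proof -
    have "sorted_wrt (\<lambda>x y. fst x \<le> fst y) ws"
      by (rule sorted_wrt_mono_rel[OF _ that(1)]) auto
    then have "sorted (map fst ws)" by (simp add: sorted_map)
    then show ?thesis using v that(2) properties_for_sort by metis
  qed
  have letters: "map letter ws = map (\<lambda>z. nat \<bar>z\<bar>) (map snd ws)" for ws :: "(nat \<times> int) list"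
    by simp
  have "bij_betw (zip v) (signings v q) (enriched {q} M)"
  proof (rule bij_betwI[of _ _ _ "map snd"])
    show "zip v \<in> signings v q \<rightarrow> enriched {q} M"
    proof
      fix zs assume zs: "zs \<in> signings v q"
      then have len: "length zs = length v" using v by (auto simp: signings_def)
      then have "map snd (zip v zs) = zs" "map fst (zip v zs) = v" by simp_all
      with zs v show "zip v zs \<in> enriched {q} M"
        unfolding enriched_def letters by (simp add: signings_def del: map_map mset_map)
    qed
    show "map snd \<in> enriched {q} M \<rightarrow> signings v q"
    proof
      fix ws assume ws: "ws \<in> enriched {q} M"
      then have "map fst ws = v" using fst_sorted by (simp add: enriched_def)
      then have "zip v (map snd ws) = ws" by (metis zip_map_fst_snd)
      with ws show "map snd ws \<in> signings v q"
        unfolding enriched_def letters by (simp add: signings_def del: map_map mset_map)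
    qed
    show "map snd (zip v zs) = zs" if "zs \<in> signings v q" for zs
      using that v by (auto simp: signings_def)
    show "zip v (map snd ws) = ws" if "ws \<in> enriched {q} M" for ws
      using that fst_sorted by (metis (mono_tags, lifting) enriched_def mem_Collect_eq zip_map_fst_snd)
  qed
  then show ?thesis by (simp add: v_def)
qed

text \<open>
  Removing \<open>1\<close> and \<open>n\<close> turns a cyclic peak set into the ordinary peak set, which satisfies the hypotheses of \<open>peak_fun_eq\<close>.
\<close>

lemma inner_cPk:
  assumes "length q = n"
  shows "cPk q - {1, n} \<subseteq> {2..<n}"
    and "s \<in> cPk q - {1, n} \<Longrightarrow> Suc s \<notin> cPk q - {1, n}"
proof -
  show sub: "cPk q - {1, n} \<subseteq> {2..<n}"
  proof
    fix s assume "s \<in> cPk q - {1, n}"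
    then have "1 \<le> s \<and> s \<le> n \<and> s \<noteq> 1 \<and> s \<noteq> n"
      using cPk_subset[of q] assms by auto
    then show "s \<in> {2..<n}" by auto
  qed
  assume "s \<in> cPk q - {1, n}"
  then have "s \<in> cPk q" "s < n" using sub by auto
  then have "Suc s \<notin> cPk q"
    using cyc_sparse_cPk[of q] assms unfolding cyc_sparse_def by auto
  then show "Suc s \<notin> cPk q - {1, n}" by blast
qed

text \<open>
  Both sides equal \<open>2\<close> to the number of distinct indices in \<open>M\<close> when each peak of \<open>q\<close> is adjacent to an ascent of the
  sorted word of \<open>M\<close>, and vanish otherwise: a block of equal indices is a stretch without ascents.
\<close>

lemma peak_fun_cPk_eq_card:
  assumes "q \<in> perms" "length q = n"
  shows "peak_fun n (cPk q - {1, n}) M = of_nat (card (enriched {q} M))"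
proof (cases "size M = n")
  case False
  then have "enriched {q} M = {}" using assms by (auto simp: enriched_def)
  moreover have "peak_fun n (cPk q - {1, n}) M = 0"
  proof (cases "n = 0")
    case True
    with False show ?thesis by (auto simp: peak_fun_def series_one_def)
  next
    case n: False
    with False show ?thesis
      by (auto simp: peak_fun_def fundamental_eq intro!: sum.neutral)
  qed
  ultimately show ?thesis by simp
next
  case M: True
  show ?thesis
  proof (cases "n = 0")
    case True
    then have "enriched {q} M = {[]}" using M assms by (auto simp: enriched_def)
    then show ?thesis using M True by (simp add: peak_fun_def series_one_def)
  next
    case False
    define v where "v = sorted_list_of_multiset M"
    define S where "S = cPk q - {1, n}"
    define J where "J = ascents M"
    have v: "mset v = M" "sorted v" "length v = n" "set v = set_mset M"
      using M unfolding v_def by (simp_all flip: size_mset)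
    have card: "card (enriched {q} M) = of_bool (no_level_peak v q) * 2 ^ card (set_mset M)"
      using bij_betw_same_card[OF bij_betw_signings_enriched[of M q]] card_signings(1)[of v q]
        M v assms False by (cases "q = []") (auto simp: perms_def v_def)
    have sub: "S \<subseteq> {2..<n}" and sparse: "\<And>s. s \<in> S \<Longrightarrow> Suc s \<notin> S"
      unfolding S_def using inner_cPk[OF assms(2)] by blast+
    have peak: "i + 2 \<in> S \<longleftrightarrow> i + 2 < n \<and> q ! i < q ! (i + 1) \<and> q ! (i + 2) < q ! (i + 1)" for i
    proof (cases "i + 2 < n")
      case True
      then have "(Suc i + (n - 1)) mod n = i" by (simp)
      with True show ?thesis
        unfolding S_def using Suc_mem_cPk[of "Suc i" q] assms(2) by auto
    next
      case False
      then show ?thesis using sub by auto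
    qed
    have le: "v ! i \<le> v ! (i + 1)" if "i + 1 < n" for i
      using v that by (simp add: sorted_nth_mono)
    have J: "i + 1 \<in> J \<longleftrightarrow> i + 1 < n \<and> v ! i \<noteq> v ! (i + 1)" for i
      using M le[of i] by (auto simp: J_def ascents_def v_def)
    have "no_level_peak v q \<longleftrightarrow> (\<forall>i. i + 2 \<in> S \<longrightarrow> i + 1 \<in> J \<or> i + 2 \<in> J)"
    proof -
      have "i + 1 \<in> J \<or> i + 2 \<in> J \<longleftrightarrow> \<not> (v ! i = v ! (i + 1) \<and> v ! (i + 1) = v ! (i + 2))"
        if "i + 2 < n" for i
        using J[of i] J[of "Suc i"] that by auto
      then show ?thesis
        using v(3) assms(2) peak no_level_peak_iff[of v q] by metis
    qed
    also have "\<dots> \<longleftrightarrow> S \<subseteq> J \<union> Suc ` J"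
    proof
      assume R: "\<forall>i. i + 2 \<in> S \<longrightarrow> i + 1 \<in> J \<or> i + 2 \<in> J"
      show "S \<subseteq> J \<union> Suc ` J"
      proof
        fix s assume s: "s \<in> S"
        then obtain i where "s = i + 2" using sub by (metis add.commute atLeastLessThan_iff le_Suc_ex subsetD)
        with R s show "s \<in> J \<union> Suc ` J" by auto
      qed
    qed auto
    finally show ?thesis
      using peak_fun_eq[of n S M] False sub sparse M unfolding card by (auto simp: S_def J_def)
  qed
qed

lemma enriched_Union: "enriched Q M = (\<Union>q\<in>Q. enriched {q} M)"
  by (auto simp: enriched_def)

lemma finite_enriched_single:  "finite (enriched {q} M)"
proof (cases "size M = length q")
  case True
  then show ?thesis using bij_betw_finite[OF bij_betw_signings_enriched] finite_signings by blast
next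
  case False
  then have "enriched {q} M = {}" by (auto simp: enriched_def)
  then show ?thesis by simp
qed

lemma card_enriched:
  assumes "finite Q"
  shows "card (enriched Q M) = (\<Sum>q\<in>Q. card (enriched {q} M))"
proof -
  have "enriched {q} M \<inter> enriched {r} M = {}" if "q \<noteq> r" for q r
    using that by (auto simp: enriched_def)
  then show ?thesis
    by (subst enriched_Union) (simp add: card_UN_disjoint assms finite_enriched_single)
qed

lemma cyc_peak_fun_eq_card:
  assumes "p \<in> perms"
  shows "cyc_peak_fun (length p) (cPk p) M = of_nat (card (enriched (cyc p) M))"
proof -
  have "cyc_peak_fun (length p) (cPk p) M = (\<Sum>q\<in>cyc p. peak_fun (length p) (cPk q - {1, length p}) M)"
    by (rule cyc_peak_fun_eq_sum[OF assms refl])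
  also have "\<dots> = (\<Sum>q\<in>cyc p. of_nat (card (enriched {q} M)))"
    using cyc_permsD[OF assms] by (intro sum.cong refl peak_fun_cPk_eq_card) auto
  finally show ?thesis using card_enriched[OF finite_cyc[OF assms], of M] by simp
qed

section \<open>The product of cyclic peak functions\<close>

lemma filter_rotate: "\<exists>l. filter P (rotate k xs) = rotate l (filter P xs)"
proof (induction k)
  case 0
  show ?case by (rule exI[of _ 0]) simp
next
  case (Suc k)
  then obtain l where l: "filter P (rotate k xs) = rotate l (filter P xs)" by blast
  have "filter P (rotate1 ys) = filter P ys \<or> filter P (rotate1 ys) = rotate1 (filter P ys)" for ys
    by (cases ys) auto
  from this[of "rotate k xs"] show ?case
  proof
    assume "filter P (rotate1 (rotate k xs)) = filter P (rotate k xs)"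
    then show ?thesis using l by auto
  next
    assume "filter P (rotate1 (rotate k xs)) = rotate1 (filter P (rotate k xs))"
    then have "filter P (rotate (Suc k) xs) = rotate (Suc l) (filter P xs)" using l by simp
    then show ?thesis by blast
  qed
qed

text \<open>
  Both words together use up all letters of a shuffle, so being a subsequence amounts to being a restriction.
\<close>

lemma mem_Sh_iff:
  assumes "p \<in> perms" "q \<in> perms" "set p \<inter> set q = {}"
  shows "t \<in> Sh p q \<longleftrightarrow> distinct t \<and> set t = set p \<union> set q
    \<and> filter (\<lambda>x. x \<in> set p) t = p \<and> filter (\<lambda>x. x \<in> set q) t = q"
proof
  assume "t \<in> Sh p q"
  then have t: "distinct t" "length t = length p + length q" "subseq p t" "subseq q t"
    by (auto simp: Sh_def perms_def)
  have sub: "set p \<subseteq> set t" "set q \<subseteq> set t" using t(3,4) by (force elim: list_emb_set)+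
  have d: "distinct p" "distinct q" using assms by (auto simp: perms_def)
  have "card (set p \<union> set q) = card (set t)"
    using assms(3) t(1,2) d by (simp add: card_Un_disjoint distinct_card)
  then have set: "set t = set p \<union> set q" using sub card_subset_eq[of "set t" "set p \<union> set q"] by simp
  have "filter (\<lambda>x. x \<in> set r) t = r" if "subseq r t" "distinct r" for r
  proof -
    have "subseq (filter (\<lambda>x. x \<in> set r) r) (filter (\<lambda>x. x \<in> set r) t)"
      using that(1) by (rule subseq_filter)
    then have "subseq r (filter (\<lambda>x. x \<in> set r) t)" by simp
    moreover have "length r = length (filter (\<lambda>x. x \<in> set r) t)"
    proof -
      have "set r \<subseteq> set t" using that(1) by (force elim: list_emb_set)
      then have "set (filter (\<lambda>x. x \<in> set r) t) = set r" by auto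
      then show ?thesis using that(2) t(1) by (metis distinct_card distinct_filter)
    qed
    ultimately show ?thesis using subseq_same_length by metis
  qed
  with t d set show "distinct t \<and> set t = set p \<union> set q
    \<and> filter (\<lambda>x. x \<in> set p) t = p \<and> filter (\<lambda>x. x \<in> set q) t = q" by blast
next
  assume t: "distinct t \<and> set t = set p \<union> set q
    \<and> filter (\<lambda>x. x \<in> set p) t = p \<and> filter (\<lambda>x. x \<in> set q) t = q"
  then have "subseq p t" "subseq q t" by (metis subseq_filter_left)+
  moreover have "length t = length p + length q"
    using t assms by (metis card_Un_disjoint distinct_card distinct_filter finite_set)
  ultimately show "t \<in> Sh p q" using t assms unfolding Sh_def perms_def by auto
qed

text \<open>
  Restricting a rotation of a word to some of its letters gives a rotation of the restriction.  Hence the set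
  of shuffles of rotations of \<open>p\<close> with rotations of \<open>q\<close> is closed under rotation, and the cyclic shuffles are its orbits.
\<close>

lemma Union_cSh:
  assumes "p \<in> perms" "q \<in> perms" "set p \<inter> set q = {}"
  shows "\<Union>(cSh (cyc p) (cyc q)) = {t. distinct t \<and> set t = set p \<union> set q
    \<and> filter (\<lambda>x. x \<in> set p) t \<in> cyc p \<and> filter (\<lambda>x. x \<in> set q) t \<in> cyc q}"
proof -
  have iff: "t \<in> Sh p' q' \<longleftrightarrow> distinct t \<and> set t = set p \<union> set q
      \<and> filter (\<lambda>x. x \<in> set p) t = p' \<and> filter (\<lambda>x. x \<in> set q) t = q'"
    if "p' \<in> cyc p" "q' \<in> cyc q" for p' q' t
    using mem_Sh_iff[of p' q' t] cyc_permsD[OF assms(1) that(1)] cyc_permsD[OF assms(2) that(2)]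
      assms(3) by simp
  show ?thesis
  proof (intro subset_antisym subsetI)
    fix t assume "t \<in> \<Union>(cSh (cyc p) (cyc q))"
    then obtain u p' q' where u: "t \<in> cyc u" "p' \<in> cyc p" "q' \<in> cyc q" "u \<in> Sh p' q'"
      unfolding cSh_def by blast
    then obtain k where k: "t = rotate k u" by (auto simp: cyc_def)
    note * = u(4)[unfolded iff[OF u(2,3)]]
    have "filter P (rotate k u) \<in> cyc r" if "filter P u \<in> cyc r" for P r
      using filter_rotate[of P k u] cyc_eq[OF that] by (auto simp: cyc_def)
    then show "t \<in> {t. distinct t \<and> set t = set p \<union> set q
      \<and> filter (\<lambda>x. x \<in> set p) t \<in> cyc p \<and> filter (\<lambda>x. x \<in> set q) t \<in> cyc q}"
      using * u(2,3) by (simp add: k)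
  next
    fix t assume t: "t \<in> {t. distinct t \<and> set t = set p \<union> set q
      \<and> filter (\<lambda>x. x \<in> set p) t \<in> cyc p \<and> filter (\<lambda>x. x \<in> set q) t \<in> cyc q}"
    then have "cyc t \<in> cSh (cyc p) (cyc q)"
      unfolding cSh_def using iff by blast
    then show "t \<in> \<Union>(cSh (cyc p) (cyc q))" using self_in_cyc by blast
  qed
qed

lemma strictly_sorted_filter_inverse:
  fixes us vs :: "(nat \<times> int) list"
  assumes "sorted_wrt (<) us" "\<And>w. w \<in> set us \<Longrightarrow> P w" "\<And>w. w \<in> set vs \<Longrightarrow> \<not> P w"
  shows "filter P (sorted_list_of_set (set us \<union> set vs)) = us"
proof (rule strict_sorted_equal)
  show "sorted_wrt (<) (filter P (sorted_list_of_set (set us \<union> set vs)))"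
    by (intro sorted_wrt_filter) simp
qed (use assms in auto)

text \<open>
  A strictly increasing list is determined by its set of entries.  So the inverse of splitting a list by letters is to
  unite the two sets of entries and sort.
\<close>

lemma bij_betw_enriched_shuffle:
  fixes A B :: "nat set"
  assumes "A \<inter> B = {}"
    and Q: "\<And>t. t \<in> Q \<Longrightarrow> distinct t \<and> set t = A" and R: "\<And>t. t \<in> R \<Longrightarrow> distinct t \<and> set t = B"
  shows "bij_betw (\<lambda>ws. (filter (\<lambda>w. letter w \<in> A) ws, filter (\<lambda>w. letter w \<in> B) ws))
    (enriched {t. distinct t \<and> set t = A \<union> B \<and> filter (\<lambda>x. x \<in> A) t \<in> Q \<and> filter (\<lambda>x. x \<in> B) t \<in> R} M)
    (\<Union>(M\<^sub>1, M\<^sub>2)\<in>{(M\<^sub>1, M\<^sub>2). M\<^sub>1 + M\<^sub>2 = M}. enriched Q M\<^sub>1 \<times> enriched R M\<^sub>2)"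
    (is "bij_betw ?f (enriched ?Z M) ?W")
proof (rule bij_betwI[of _ _ _ "\<lambda>(us, vs). sorted_list_of_set (set us \<union> set vs)"])
  have inA: "letter w \<in> A" if "us \<in> enriched Q M'" "w \<in> set us" for us w M'
    using that Q[of "map letter us"] by (auto simp: enriched_def)
  have inB: "letter w \<in> B" if "vs \<in> enriched R M'" "w \<in> set vs" for vs w M'
    using that R[of "map letter vs"] by (auto simp: enriched_def)
  have inAB: "letter w \<in> A \<union> B" if "ws \<in> enriched ?Z M" "w \<in> set ws" for ws w
  proof -
    have "set (map letter ws) = A \<union> B" using that(1) by (simp add: enriched_def)
    then show ?thesis using that(2) by auto
  qed
  show "?f \<in> enriched ?Z M \<rightarrow> ?W"
  proof
    fix ws assume ws: "ws \<in> enriched ?Z M"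
    define us where "us = filter (\<lambda>w. letter w \<in> A) ws"
    define vs where "vs = filter (\<lambda>w. letter w \<in> B) ws"
    have maps: "map letter us = filter (\<lambda>x. x \<in> A) (map letter ws)"
        "map letter vs = filter (\<lambda>x. x \<in> B) (map letter ws)"
      by (simp_all add: us_def vs_def filter_map comp_def)
    have "filter_mset (\<lambda>w. letter w \<in> B) (mset ws) = filter_mset (\<lambda>w. letter w \<notin> A) (mset ws)"
      using inAB[OF ws] assms(1) by (intro filter_mset_cong) auto
    then have "mset us + mset vs = mset ws"
      by (simp add: us_def vs_def flip: multiset_partition)
    then have "mset (map fst us) + mset (map fst vs) = mset (map fst ws)"
      by (simp flip: image_mset_union)
    then have "mset (map fst us) + mset (map fst vs) = M"
      using ws by (simp add: enriched_def)
    moreover have "sorted_wrt (<) us" "sorted_wrt (<) vs"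
      using ws by (auto simp: enriched_def us_def vs_def intro: sorted_wrt_filter)
    then have "us \<in> enriched Q (mset (map fst us))" "vs \<in> enriched R (mset (map fst vs))"
      using ws unfolding enriched_def mem_Collect_eq maps by blast+
    ultimately have "(us, vs) \<in> ?W" by blast
    then show "?f ws \<in> ?W" by (simp add: us_def vs_def)
  qed
  show "(case ?f ws of (us, vs) \<Rightarrow> sorted_list_of_set (set us \<union> set vs)) = ws"
    if ws: "ws \<in> enriched ?Z M" for ws
  proof -
    have "set (filter (\<lambda>w. letter w \<in> A) ws) \<union> set (filter (\<lambda>w. letter w \<in> B) ws) = set ws"
      using inAB[OF ws] by auto
    moreover have "sorted_wrt (<) ws" using ws by (simp add: enriched_def)
    ultimately show ?thesis by (simp add: strict_sorted_equal)
  qed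
  have inv: "?f (sorted_list_of_set (set us \<union> set vs)) = (us, vs)"
    if "us \<in> enriched Q M\<^sub>1" "vs \<in> enriched R M\<^sub>2" for us vs M\<^sub>1 M\<^sub>2
  proof -
    have "sorted_wrt (<) us" "sorted_wrt (<) vs" using that by (auto simp: enriched_def)
    moreover have "letter w \<in> A" "letter w \<notin> B" if "w \<in> set us" for w
      using inA[OF \<open>us \<in> enriched Q M\<^sub>1\<close> that] assms(1) by auto
    moreover have "letter w \<in> B" "letter w \<notin> A" if "w \<in> set vs" for w
      using inB[OF \<open>vs \<in> enriched R M\<^sub>2\<close> that] assms(1) by auto
    ultimately show ?thesis
      using strictly_sorted_filter_inverse[of us "\<lambda>w. letter w \<in> A" vs]
        strictly_sorted_filter_inverse[of vs "\<lambda>w. letter w \<in> B" us]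
      by (simp add: Un_commute)
  qed
  show "?f (case y of (us, vs) \<Rightarrow> sorted_list_of_set (set us \<union> set vs)) = y" if "y \<in> ?W" for y
    using that inv by force
  show "(\<lambda>(us, vs). sorted_list_of_set (set us \<union> set vs)) \<in> ?W \<rightarrow> enriched ?Z M"
  proof
    fix y assume "y \<in> ?W"
    then obtain us vs M\<^sub>1 M\<^sub>2 where y: "y = (us, vs)" and M: "M\<^sub>1 + M\<^sub>2 = M"
      and us: "us \<in> enriched Q M\<^sub>1" and vs: "vs \<in> enriched R M\<^sub>2" by blast
    define ws where "ws = sorted_list_of_set (set us \<union> set vs)"
    have set: "set ws = set us \<union> set vs" by (simp add: ws_def)
    have su: "sorted_wrt (<) us" "map letter us \<in> Q" "mset (map fst us) = M\<^sub>1"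
      and sv: "sorted_wrt (<) vs" "map letter vs \<in> R" "mset (map fst vs) = M\<^sub>2"
      using us vs by (auto simp: enriched_def)
    have du: "distinct (map letter us)" "set (map letter us) = A" using Q[OF su(2)] by auto
    have dv: "distinct (map letter vs)" "set (map letter vs) = B" using R[OF sv(2)] by auto
    have disj: "set us \<inter> set vs = {}" using inA[OF us] inB[OF vs] assms(1) by blast
    have "mset ws = mset_set (set us \<union> set vs)"
      using mset_set_set[of ws] unfolding set by (simp add: ws_def)
    also have "\<dots> = mset_set (set us) + mset_set (set vs)"
      using disj by (simp add: mset_set_Union)
    also have "\<dots> = mset us + mset vs"
      using du(1) dv(1) by (simp add: distinct_map mset_set_set)
    finally have ms: "mset ws = mset us + mset vs" .
    have "mset (map letter ws) = mset (map letter us @ map letter vs)" using ms by simp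
    moreover have "distinct (map letter us @ map letter vs)"
      unfolding distinct_append using du dv assms(1) by simp
    ultimately have d: "distinct (map letter ws)" by (metis mset_eq_imp_distinct_iff)
    have "filter (\<lambda>w. letter w \<in> A) ws = us" "filter (\<lambda>w. letter w \<in> B) ws = vs"
      using inv[OF us vs] by (simp_all add: ws_def)
    then have "filter (\<lambda>x. x \<in> A) (map letter ws) = map letter us"
        "filter (\<lambda>x. x \<in> B) (map letter ws) = map letter vs"
      by (simp_all add: filter_map comp_def)
    moreover have "set (map letter ws) = A \<union> B"
      using du(2) dv(2) by (simp add: set image_Un)
    moreover have "mset (map fst ws) = M" using ms su(3) sv(3) M by simp
    moreover have "sorted_wrt (<) ws" by (simp add: ws_def)
    ultimately have "ws \<in> enriched ?Z M" using d su sv unfolding enriched_def by simp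
    then show "(case y of (us, vs) \<Rightarrow> sorted_list_of_set (set us \<union> set vs)) \<in> enriched ?Z M"
      by (simp add: y ws_def)
  qed
qed

abbreviation splittings :: "nat multiset \<Rightarrow> (nat multiset \<times> nat multiset) set" where
  "splittings M \<equiv> {(A, B). A + B = M}"

definition conv :: "series \<Rightarrow> series \<Rightarrow> series" where
  "conv f g M = (\<Sum>(A, B)\<in>splittings M. f A * g B)"

lemma finite_splittings: "finite (splittings M)"
proof (rule finite_subset)
  show "{(A, B). A + B = M} \<subseteq> {A. A \<subseteq># M} \<times> {A. A \<subseteq># M}" by auto
  have "finite {A. A \<subseteq># M}"
  proof (induction M)
    case (add x M)
    have "A \<in> {A. A \<subseteq># M} \<union> add_mset x ` {A. A \<subseteq># M}" if "A \<subseteq># add_mset x M" for A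
    proof (cases "x \<in># A")
      case True
      then obtain B where "A = add_mset x B" by (metis insert_DiffM)
      with that show ?thesis by simp
    next
      case False
      with that subset_eq_diff_conv[of A "{#x#}" M] show ?thesis by (simp add: diff_single_trivial)
    qed
    then have "{A. A \<subseteq># add_mset x M} \<subseteq> {A. A \<subseteq># M} \<union> add_mset x ` {A. A \<subseteq># M}" by blast
    with add show ?case by (meson finite_UnI finite_imageI finite_subset)
  qed simp
  then show "finite ({A. A \<subseteq># M} \<times> {A. A \<subseteq># M})" by simp
qed

lemma finite_enriched: "finite Q \<Longrightarrow> finite (enriched Q M)"
  by (subst enriched_Union) (simp add: finite_enriched_single)

text \<open>
  Both sides count the enriched partitions of weight \<open>M\<close> whose underlying word is a member of a cyclic shuffle of
  \<open>[p]\<close> and \<open>[q]\<close>: on the left they are split by letters, on the right they are grouped by cyclic permutations.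
\<close>

lemma cyc_peak_fun_mult:
  assumes "p \<in> perms" "q \<in> perms" "set p \<inter> set q = {}"
  shows "conv (cyc_peak_fun (length p) (cPk p)) (cyc_peak_fun (length q) (cPk q)) M
    = (\<Sum>c\<in>cSh (cyc p) (cyc q). of_nat (card (enriched c M)))"
proof -
  let ?P = "splittings M"
  have fin: "finite (cyc p)" "finite (cyc q)" using finite_cyc assms by auto
  have rot: "distinct t \<and> set t = set p" if "t \<in> cyc p" for t
    using cyc_permsD[OF assms(1) that] by (simp add: perms_def)
  have rot': "distinct t \<and> set t = set q" if "t \<in> cyc q" for t
    using cyc_permsD[OF assms(2) that] by (simp add: perms_def)
  have "card (enriched (\<Union>(cSh (cyc p) (cyc q))) M)
      = card (\<Union>(A, B)\<in>?P. enriched (cyc p) A \<times> enriched (cyc q) B)"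
    unfolding Union_cSh[OF assms]
    by (rule bij_betw_same_card[OF bij_betw_enriched_shuffle[OF assms(3) rot rot']])
  also have "\<dots> = (\<Sum>y\<in>?P. card (case y of (A, B) \<Rightarrow> enriched (cyc p) A \<times> enriched (cyc q) B))"
  proof (intro card_UN_disjoint ballI impI finite_splittings)
    fix y assume "y \<in> ?P"
    show "finite (case y of (A, B) \<Rightarrow> enriched (cyc p) A \<times> enriched (cyc q) B)"
      by (simp add: case_prod_beta finite_enriched fin)
  next
    fix y z :: "nat multiset \<times> nat multiset" assume "y \<noteq> z"
    moreover obtain A B A' B' where "y = (A, B)" "z = (A', B')" by (cases y; cases z)
    ultimately show "(case y of (A, B) \<Rightarrow> enriched (cyc p) A \<times> enriched (cyc q) B) \<inter>
        (case z of (A, B) \<Rightarrow> enriched (cyc p) A \<times> enriched (cyc q) B) = {}"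
      unfolding enriched_def by blast
  qed
  finally have 1: "card (enriched (\<Union>(cSh (cyc p) (cyc q))) M)
    = (\<Sum>(A, B)\<in>?P. card (enriched (cyc p) A) * card (enriched (cyc q) B))"
    by (simp add: card_cartesian_product case_prod_beta)
  have fin': "finite c" if "c \<in> cSh (cyc p) (cyc q)" for c
    using cSh_memD(1)[OF assms(1,2) that] finite_cyc by (auto simp: cyclic_perms_def)
  have "card (enriched (\<Union>(cSh (cyc p) (cyc q))) M)
    = (\<Sum>t\<in>\<Union>(cSh (cyc p) (cyc q)). card (enriched {t} M))"
    using finite_cSh[OF assms] fin' by (intro card_enriched) auto
  also have "\<dots> = (\<Sum>c\<in>cSh (cyc p) (cyc q). \<Sum>t\<in>c. card (enriched {t} M))"
  proof (subst sum.Union_disjoint)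
    show "\<forall>c\<in>cSh (cyc p) (cyc q). \<forall>d\<in>cSh (cyc p) (cyc q). c \<noteq> d \<longrightarrow> c \<inter> d = {}"
    proof (intro ballI impI)
      fix c d assume cd: "c \<in> cSh (cyc p) (cyc q)" "d \<in> cSh (cyc p) (cyc q)" "c \<noteq> d"
      then obtain u v where "c = cyc u" "d = cyc v" unfolding cSh_def by blast
      then have "c = d" if "t \<in> c" "t \<in> d" for t using that cyc_eq by metis
      with cd(3) show "c \<inter> d = {}" by blast
    qed
  qed (use fin' in auto)
  also have "\<dots> = (\<Sum>c\<in>cSh (cyc p) (cyc q). card (enriched c M))"
    using fin' by (intro sum.cong refl card_enriched[symmetric])
  finally have 2: "(\<Sum>(A, B)\<in>?P. card (enriched (cyc p) A) * card (enriched (cyc q) B))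
    = (\<Sum>c\<in>cSh (cyc p) (cyc q). card (enriched c M))" using 1 by simp
  have "(\<Sum>(A, B)\<in>?P. cyc_peak_fun (length p) (cPk p) A * cyc_peak_fun (length q) (cPk q) B)
    = of_nat (\<Sum>(A, B)\<in>?P. card (enriched (cyc p) A) * card (enriched (cyc q) B))"
    unfolding cyc_peak_fun_eq_card[OF assms(1)] cyc_peak_fun_eq_card[OF assms(2)]
    by (simp add: case_prod_beta)
  then show ?thesis unfolding conv_def 2 by simp
qed

section \<open>Linear independence of the cyclic peak functions\<close>

text \<open>
  The sorted word whose entry at position \<open>i\<close> is the number of elements of \<open>J\<close> up to \<open>i\<close> increases exactly at \<open>J\<close>.
\<close>

lemma exists_mset_with_ascents:
  assumes "J \<subseteq> {1..<n}"
  shows "\<exists>M. size M = n \<and> ascents M = J"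
proof -
  define v where "v = map (\<lambda>i. card (J \<inter> {..i})) [0..<n]"
  have fin: "finite (J \<inter> {..i})" for i by simp
  have sorted: "sorted v"
    unfolding v_def sorted_map
    by (rule sorted_wrt_mono_rel[of _ "(\<le>)"]) (auto intro!: card_mono)
  then have s: "sorted_list_of_multiset (mset v) = v" by (simp add: sorted_sort_id)
  have "v ! (j - 1) < v ! j \<longleftrightarrow> j \<in> J" if "j \<in> {1..<n}" for j
  proof -
    from that obtain i where i: "j = Suc i" "Suc i < n" by (cases j) auto
    have "J \<inter> {..Suc i} = (if Suc i \<in> J then insert (Suc i) (J \<inter> {..i}) else J \<inter> {..i})"
      by (auto simp: le_Suc_eq)
    then show ?thesis using i by (simp add: v_def)
  qed
  then have "{j \<in> {1..<n}. v ! (j - 1) < v ! j} = J" using assms by blast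
  moreover have size: "size (mset v) = n" by (simp add: v_def)
  ultimately have "ascents (mset v) = J" unfolding ascents_def s size by simp
  with size show ?thesis by blast
qed

text \<open>
  Each element of \<open>R'\<close> is \<open>x\<close> or \<open>x - 1\<close> for some \<open>x \<in> R\<close>, and different elements can be assigned different \<open>x\<close>
  because \<open>R'\<close> contains no two consecutive numbers.  So passing from \<open>R'\<close> to its image in \<open>R\<close> only raises elements.
\<close>

lemma subset_pred_Un_sum_le:
  assumes "finite R" "R' \<subseteq> (\<lambda>x. x - 1) ` R \<union> R" "\<And>x. x \<in> R' \<Longrightarrow> Suc x \<notin> R'" "0 \<notin> R"
  shows "R' = R \<or> \<Sum>R' < (\<Sum>R::nat)"
proof -
  define g where "g x = (if x \<in> R then x else Suc x)" for x
  have gR: "g x \<in> R" if x: "x \<in> R'" for x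
  proof (cases "x \<in> R")
    case False
    then obtain y where "y \<in> R" "x = y - 1" using assms(2) x by blast
    with False show ?thesis by (cases y) (auto simp: g_def)
  qed (simp add: g_def)
  have inj: "inj_on g R'"
    using assms(3) by (auto simp: inj_on_def g_def split: if_splits)
  have fin': "finite R'" using assms(1,2) finite_subset by blast
  have le: "x \<le> g x" for x by (simp add: g_def)
  have "\<Sum>R' \<le> (\<Sum>x\<in>R'. g x)" by (intro sum_mono le)
  also have "\<dots> = \<Sum>(g ` R')" using inj by (simp add: sum.reindex)
  also have "\<dots> \<le> \<Sum>R" using gR assms(1) by (intro sum_mono2) auto
  finally have "\<Sum>R' \<le> \<Sum>R" .
  moreover have "R' = R" if eq: "\<Sum>R' = \<Sum>R"
  proof -
    have e: "\<Sum>(g ` R') = \<Sum>R" "\<Sum>R' = (\<Sum>x\<in>R'. g x)"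
      using \<open>\<Sum>R' \<le> (\<Sum>x\<in>R'. g x)\<close> \<open>(\<Sum>x\<in>R'. g x) = \<Sum>(g ` R')\<close> \<open>\<Sum>(g ` R') \<le> \<Sum>R\<close> eq by auto
    have g: "g x = x" if "x \<in> R'" for x
    proof (rule ccontr)
      assume "g x \<noteq> x"
      then have "x < g x" using le[of x] by simp
      then have "\<Sum>R' < (\<Sum>x\<in>R'. g x)" using fin' that le by (intro sum_strict_mono_ex1) auto
      with e show False by simp
    qed
    then have "R' \<subseteq> R" using gR by force
    moreover have "\<Sum>(R - R') = 0"
      using sum.subset_diff[OF \<open>R' \<subseteq> R\<close> assms(1), of "\<lambda>x. x"] eq by simp
    then have "R - R' \<subseteq> {0}" using assms(1) by auto
    ultimately show ?thesis using assms(4) by blast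
  qed
  ultimately show ?thesis by linarith
qed

text \<open>
  Among the sets without consecutive elements, the relation for \<open>J = R - 1\<close> involves \<open>R\<close> itself and, besides, only
  sets with smaller sum of elements, so the system is triangular.
\<close>

lemma peak_coefficients_determined:
  fixes r :: "nat set \<Rightarrow> 'a::comm_ring_1"
  assumes supp: "\<And>R. r R \<noteq> 0 \<Longrightarrow> R \<subseteq> {2..<n} \<and> (\<forall>x\<in>R. Suc x \<notin> R)"
    and rel: "\<And>J. J \<subseteq> {1..<n} \<Longrightarrow> (\<Sum>R\<in>Pow {2..<n}. of_bool (R \<subseteq> J \<union> Suc ` J) * r R) = 0"
  shows "r R = 0"
proof (induction "\<Sum>R" arbitrary: R rule: less_induct)
  case less
  show ?case
  proof (rule ccontr)
    assume "r R \<noteq> 0"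
    then have R: "R \<subseteq> {2..<n}" using supp by blast
    then have finR: "finite R" using finite_subset by blast
    define J where "J = (\<lambda>x. x - 1) ` R"
    have "x - 1 \<in> {1..<n}" if "x \<in> R" for x using subsetD[OF R that] by auto
    then have J: "J \<subseteq> {1..<n}" by (auto simp: J_def)
    have "Suc ` J = (\<lambda>x. x) ` R"
      unfolding J_def image_image using R by (intro image_cong) auto
    then have SJ: "Suc ` J = R" by simp
    have "of_bool (R' \<subseteq> J \<union> Suc ` J) * r R' = (if R' = R then r R else 0)" for R'
    proof (cases "r R' = 0 \<or> \<not> R' \<subseteq> J \<union> R")
      case False
      then have "R' = R \<or> \<Sum>R' < \<Sum>R"
        using subset_pred_Un_sum_le[OF finR, of R'] supp[of R'] subsetD[OF R, of 0] by (auto simp: J_def)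
      with less[of R'] False show ?thesis using SJ by auto
    qed (use SJ in auto)
    then have "(\<Sum>R'\<in>Pow {2..<n}. of_bool (R' \<subseteq> J \<union> Suc ` J) * r R')
      = (\<Sum>R'\<in>Pow {2..<n}. if R' = R then r R else 0)" by simp
    also have "\<dots> = r R" using R by (simp add: sum.delta)
    finally show False using rel[OF J] \<open>r R \<noteq> 0\<close> by simp
  qed
qed

text \<open>
  The proof is by induction on the size of \<open>U\<close>.  For a set \<open>V\<close> smaller than \<open>U\<close> the term \<open>f V\<close> vanishes, so the
  relation, shifted so that \<open>1\<close> and \<open>n\<close> become \<open>j\<close> and \<open>j - 1\<close>, says that \<open>f (V \<union> {j})\<close> and \<open>f (V \<union> {j - 1})\<close> are
  opposite: moving one element down by \<open>1\<close> changes the sign of \<open>f\<close>.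
  If \<open>U\<close> has at least two elements, then its second smallest element can be moved down until it is adjacent to the
  smallest, where \<open>f\<close> vanishes.  If \<open>U\<close> is a singleton, then all singletons are shifts of each other,
  so the sign change gives \<open>2 * f U = 0\<close>.
\<close>

lemma shift_invariant_vanishes:
  fixes f :: "nat set \<Rightarrow> 'a::field_char_0"
  assumes n: "2 \<le> n"
    and inv: "\<And>U j. U \<subseteq> {1..n} \<Longrightarrow> j \<le> n \<Longrightarrow> f (cyc_shift n j U) = f U"
    and supp: "\<And>U. f U \<noteq> 0 \<Longrightarrow> U \<noteq> {} \<and> cyc_sparse n U"
    and rel: "\<And>R. R \<subseteq> {2..<n} \<Longrightarrow> f R + f (insert 1 R) + f (insert n R) = 0"
    and U: "U \<subseteq> {1..n}"
  shows "f U = 0"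
  using U
proof (induction "card U" arbitrary: U rule: less_induct)
  case less
  have move: "f (insert j V) + f (insert (j - 1) V) = 0"
    if "V \<subseteq> {1..n}" "card V < card U" "j \<in> {2..n}" "j \<notin> V" "j - 1 \<notin> V" for V j
  proof -
    \<comment> \<open>The shift by \<open>n + 1 - j\<close> takes \<open>j\<close> to \<open>1\<close> and \<open>j - 1\<close> to \<open>n\<close>.\<close>
    define i where "i = n + 1 - j"
    define s where "s x = (x + i - 1) mod n + 1" for x
    have shift: "cyc_shift n i W = s ` W" for W by (simp add: cyc_shift_def s_def)
    have n': "i \<le> n" "0 < n" using that(3) by (auto simp: i_def)
    have s1: "s j = 1" using that(3) n by (simp add: s_def i_def)
    have sn: "s (j - 1) = n"
    proof -
      have "j - 1 + i - 1 = n - 1" using that(3) by (auto simp: i_def)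
      then show ?thesis using n by (simp add: s_def)
    qed
    have other: "s x \<in> {2..<n}" if x: "x \<in> {1..n}" "x \<noteq> j" "x \<noteq> j - 1" for x
    proof (cases "j < x")
      case True
      then have "x + i - 1 = (x - j) + n" using x n by (auto simp: i_def)
      moreover have "x - j < n" using x \<open>j \<in> {2..n}\<close> by auto
      ultimately have "s x = x - j + 1" by (simp add: s_def)
      then show ?thesis using True x \<open>j \<in> {2..n}\<close> by auto
    next
      case False
      then have "s x = x + i - 1 + 1" using x \<open>j \<in> {2..n}\<close> unfolding s_def i_def
        by (subst mod_less) auto
      then show ?thesis using False x \<open>j \<in> {2..n}\<close> by (auto simp: i_def)
    qed
    have sV: "s ` V \<subseteq> {2..<n}" using other that by blast
    have "f (s ` V) = 0"
      using inv[OF that(1) n'(1)] less(1)[OF that(2,1)] by (simp add: shift)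
    moreover have "f (insert 1 (s ` V)) = f (insert j V)"
      using inv[of "insert j V", OF _ n'(1)] that(1,3) by (simp add: shift s1)
    moreover have "f (insert n (s ` V)) = f (insert (j - 1) V)"
    proof -
      have "insert (j - 1) V \<subseteq> {1..n}" using that(1,3) by auto
      from inv[OF this n'(1)] show ?thesis unfolding shift image_insert sn .
    qed
    ultimately show ?thesis using rel[OF sV] by simp
  qed
  have fin: "finite U" using less.prems finite_subset by blast
  have gap: "f (insert (b + d) V) = 0"
    if "V \<subseteq> {1..n}" "card V < card U" "b \<in> V" "b + d \<le> n" "0 < d" "V \<inter> {b<..b + d} = {}" for V b d
    using that(4-6)
  proof (induction d)
    case (Suc d)
    have b: "1 \<le> b" using that by auto
    show ?case
    proof (cases "d = 0")
      case True
      have "b \<in> insert (b + Suc d) V" "b mod n + 1 \<in> insert (b + Suc d) V"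
        using that(3) Suc.prems True by auto
      then have "\<not> cyc_sparse n (insert (b + Suc d) V)"
        unfolding cyc_sparse_def by blast
      then show ?thesis using supp by blast
    next
      case False
      then have "f (insert (b + d) V) = 0" using Suc by (intro Suc.IH) auto
      moreover have "f (insert (b + Suc d) V) + f (insert (b + Suc d - 1) V) = 0"
        using Suc.prems b False by (intro move[OF that(1,2)]) auto
      ultimately show ?thesis by simp
    qed
  qed simp
  show "f U = 0"
  proof (cases "U = {}")
    case True
    then show ?thesis using supp by blast
  next
    case nonempty: False
    define b where "b = Min U"
    have b: "b \<in> U" "\<And>x. x \<in> U \<Longrightarrow> b \<le> x" using fin nonempty by (auto simp: b_def)
    show ?thesis
    proof (cases "U = {b}")
      case True
      have "f {2} + f {2 - 1} = 0"
        using move[of "{}" 2] n True by simp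
      moreover have "f {k} = f {n}" if k: "k \<in> {1..n}" for k
      proof -
        from k obtain l where "k = Suc l" "l < n" by (cases k) auto
        then have "cyc_shift n k {n} = {k}" by (simp add: cyc_shift_def)
        then show ?thesis using inv[of "{n}" k] n k by auto
      qed
      from this[of 2] this[of 1] this[of b]
      have "f {2} = f {n}" "f {1} = f {n}" "f {b} = f {n}" using n b(1) less.prems by auto
      ultimately show ?thesis using True by simp
    next
      case False
      then have ne: "U - {b} \<noteq> {}" using b by auto
      define a where "a = Min (U - {b})"
      have a: "a \<in> U - {b}" "\<And>x. x \<in> U - {b} \<Longrightarrow> a \<le> x"
        using fin ne Min_in[of "U - {b}"] by (auto simp: a_def)
      have "b < a" using a(1) b(2)[of a] by auto
      moreover have "(U - {a}) \<inter> {b<..b + (a - b)} = {}" using a(2) \<open>b < a\<close> by fastforce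
      moreover have "card (U - {a}) < card U" using fin a(1) by (intro psubset_card_mono) auto
      ultimately have "f (insert (b + (a - b)) (U - {a})) = 0"
        using less.prems a(1) b(1) by (intro gap) auto
      moreover have "insert (b + (a - b)) (U - {a}) = U" using a(1) \<open>b < a\<close> by auto
      ultimately show ?thesis by simp
    qed
  qed
qed

lemma sum_Pow_insert:
  assumes "finite A" "x \<notin> A"
  shows "(\<Sum>U\<in>Pow (insert x A). h U) = (\<Sum>U\<in>Pow A. h U + h (insert x U))"
proof -
  have "inj_on (insert x) (Pow A)" using assms(2) by (auto simp: inj_on_def)
  moreover have "Pow A \<inter> insert x ` Pow A = {}" using assms(2) by auto
  ultimately show ?thesis
    using assms(1) by (simp add: Pow_insert sum.union_disjoint sum.reindex sum.distrib)
qed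

lemma cyc_peak_fun_neq_size:
  assumes "p \<in> perms" "size M \<noteq> length p"
  shows "cyc_peak_fun (length p) (cPk p) M = 0"
proof -
  have "length q = length p" if "q \<in> cyc p" for q using cyc_permsD(1)[OF assms(1) that] .
  then have "enriched (cyc p) M = {}" using assms(2) by (force simp: enriched_def)
  then show ?thesis by (simp add: cyc_peak_fun_eq_card[OF assms(1)])
qed

text \<open>
  The peak functions in a linear relation are collected by the cyclic peak set they come from: \<open>f U\<close> is the total coefficient
  with which the rotations having cyclic peak set \<open>U\<close> occur.  For \<open>R \<subseteq> {2, \<dots>, n - 1}\<close> the cyclic peak sets \<open>R\<close>, \<open>R \<union> {1}\<close>
  and \<open>R \<union> {n}\<close> all give the ordinary peak set \<open>R\<close>, and this is where the relation on \<open>f\<close> in \<open>shift_invariant_vanishes\<close> comes from.  Conversely \<open>f\<close> determines the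
  coefficients of the relation, since cyclic peak sets of rotations of words from different classes are different.
\<close>

lemma cyc_peak_fun_independent:
  fixes a :: "nat list \<Rightarrow> rat"
  assumes fin: "finite P" and sub: "P \<subseteq> perms"
    and inj: "\<And>p q. p \<in> P \<Longrightarrow> q \<in> P \<Longrightarrow> length p = length q \<Longrightarrow>
      cPk_cyc (cyc p) = cPk_cyc (cyc q) \<Longrightarrow> p = q"
    and rel: "\<And>M. (\<Sum>p\<in>P. a p * cyc_peak_fun (length p) (cPk p) M) = 0"
    and p0: "p\<^sub>0 \<in> P"
  shows "a p\<^sub>0 = 0"
proof -
  define n where "n = length p\<^sub>0"
  define P' where "P' = {p \<in> P. length p = n}"
  have P': "finite P'" "p\<^sub>0 \<in> P'" using fin p0 by (auto simp: P'_def n_def)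
  have P'D: "p \<in> perms" "length p = n" if "p \<in> P'" for p using that sub by (auto simp: P'_def)
  have rel': "(\<Sum>p\<in>P'. a p * cyc_peak_fun n (cPk p) M) = 0" if "size M = n" for M
  proof -
    have "(\<Sum>p\<in>P. a p * cyc_peak_fun (length p) (cPk p) M)
        = (\<Sum>p\<in>P'. a p * cyc_peak_fun (length p) (cPk p) M)"
    proof (rule sum.mono_neutral_right[OF fin])
      show "\<forall>p\<in>P - P'. a p * cyc_peak_fun (length p) (cPk p) M = 0"
      proof
        fix p assume "p \<in> P - P'"
        then have "p \<in> perms" "size M \<noteq> length p" using sub that by (auto simp: P'_def)
        then show "a p * cyc_peak_fun (length p) (cPk p) M = 0"
          using cyc_peak_fun_neq_size by simp
      qed
    qed (auto simp: P'_def)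
    then show ?thesis using rel[of M] P'D by simp
  qed
  show ?thesis
  proof (cases "n < 2")
    case True
    \<comment> \<open>Words with fewer than two letters have no cyclic peaks, so the length leaves only one class; its cyclic
      peak function is nonzero because a single index with positive letters is an enriched partition.\<close>
    have "cPk p = {}" if "length p < 2" for p
      using that by (auto simp: cPk_def Let_def less_2_cases_iff)
    then have "p = p\<^sub>0" if "p \<in> P'" for p
      using cPk_cyc_eq[of p "p\<^sub>0"] inj[of p "p\<^sub>0"] P'D[OF that] P'D[OF P'(2)] that P'(2) True
      by (auto simp: P'_def)
    then have P'_eq: "P' = {p\<^sub>0}" using P'(2) by blast
    define M where "M = replicate_mset n (0::nat)"
    define ws where "ws = map (\<lambda>x. (0::nat, int x)) p\<^sub>0"
    have "sorted_wrt (<) ws" using True by (cases "p\<^sub>0"; cases "tl p\<^sub>0") (auto simp: ws_def n_def)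
    moreover have "map letter ws = p\<^sub>0" by (simp add: ws_def comp_def)
    moreover have "mset (map fst ws) = M"
      by (simp add: ws_def M_def n_def comp_def image_mset_const_eq)
    ultimately have "ws \<in> enriched (cyc p\<^sub>0) M"
      using self_in_cyc[of "p\<^sub>0"] by (simp add: enriched_def)
    moreover have perm: "p\<^sub>0 \<in> perms" using P'D(1)[OF P'(2)] .
    ultimately have "card (enriched (cyc p\<^sub>0) M) \<noteq> 0"
      using finite_enriched[OF finite_cyc[OF perm]] by auto
    then show ?thesis
      using rel'[of M] cyc_peak_fun_eq_card[OF perm, of M] by (simp add: P'_eq M_def n_def)
  next
    case n2: False
    define f where "f U = (\<Sum>p\<in>P'. a p * of_nat (count (cPk_cyc (cyc p)) U))" for U
    have countD: "\<exists>q\<in>cyc p. cPk q = U" if "p \<in> P'" "count (cPk_cyc (cyc p)) U \<noteq> 0" for p U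
      using that P'D[OF that(1)] by (auto simp: count_cPk_cyc card_eq_0_iff)
    have supp: "U \<noteq> {} \<and> cyc_sparse n U \<and> U \<subseteq> {1..n}" if "f U \<noteq> 0" for U
    proof -
      from that obtain p where "p \<in> P'" "count (cPk_cyc (cyc p)) U \<noteq> 0"
        unfolding f_def by (metis (mono_tags, lifting) mult_zero_right of_nat_0 sum.neutral)
      then obtain q where "q \<in> perms" "length q = n" "cPk q = U"
        using countD P'D cyc_permsD by metis
      then show ?thesis
        using cPk_nonempty[of q] cyc_sparse_cPk[of q] cPk_subset[of q] n2 by auto
    qed
    have inv: "f (cyc_shift n j U) = f U" if "U \<subseteq> {1..n}" "j \<le> n" for U j
      unfolding f_def
    proof (intro sum.cong refl)
      fix p assume "p \<in> P'"
      then have "p \<in> perms" "length p = n" "p \<noteq> []" using P'D n2 by fastforce+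
      then show "a p * of_nat (count (cPk_cyc (cyc p)) (cyc_shift n j U))
          = a p * of_nat (count (cPk_cyc (cyc p)) U)"
        using count_cPk_cyc_shift[of p U j] that by simp
    qed
    have range: "{1..n} = insert 1 (insert n {2..<n})" using n2 by auto
    define r where "r R = (if R \<subseteq> {2..<n} then f R + f (insert 1 R) + f (insert n R) else 0)" for R
    have r_rel: "(\<Sum>R\<in>Pow {2..<n}. of_bool (R \<subseteq> J \<union> Suc ` J) * r R) = 0" if J: "J \<subseteq> {1..<n}" for J
    proof -
      obtain M where M: "size M = n" "ascents M = J" using exists_mset_with_ascents[OF J] by blast
      define g where "g U = of_bool (U - {1, n} \<subseteq> J \<union> Suc ` J) * (2::rat) ^ card (set_mset M)" for U
      have K: "cyc_peak_fun n (cPk p) M = (\<Sum>U\<in>Pow {1..n}. of_nat (count (cPk_cyc (cyc p)) U) * g U)"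
        if "p \<in> P'" for p
      proof -
        have p: "p \<in> perms" "length p = n" using P'D[OF that] by auto
        have "cyc_peak_fun n (cPk p) M = (\<Sum>q\<in>cyc p. peak_fun n (cPk q - {1, n}) M)"
          by (rule cyc_peak_fun_eq_sum[OF p])
        also have "\<dots> = (\<Sum>q\<in>cyc p. g (cPk q))"
        proof (intro sum.cong refl)
          fix q assume "q \<in> cyc p"
          then have "length q = n" using cyc_permsD(1)[OF p(1)] p(2) by simp
          then show "peak_fun n (cPk q - {1, n}) M = g (cPk q)"
            using peak_fun_eq[of n "cPk q - {1, n}" M] inner_cPk[of q n] n2 M by (simp add: g_def)
        qed
        also have "\<dots> = (\<Sum>U\<in>Pow {1..n}. \<Sum>q\<in>{q \<in> cyc p. cPk q = U}. g (cPk q))"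
          using cPk_subset cyc_permsD(1)[OF p(1)] p(2)
          by (intro sum.group[symmetric] finite_cyc[OF p(1)]) fastforce+
        also have "\<dots> = (\<Sum>U\<in>Pow {1..n}. of_nat (count (cPk_cyc (cyc p)) U) * g U)"
          using count_cPk_cyc[OF p(1)] by (intro sum.cong refl) simp
        finally show ?thesis .
      qed
      have "0 = (\<Sum>p\<in>P'. a p * cyc_peak_fun n (cPk p) M)" using rel'[OF M(1)] by simp
      also have "\<dots> = (\<Sum>p\<in>P'. \<Sum>U\<in>Pow {1..n}. a p * of_nat (count (cPk_cyc (cyc p)) U) * g U)"
        using K by (simp add: sum_distrib_left mult.assoc)
      also have "\<dots> = (\<Sum>U\<in>Pow {1..n}. f U * g U)"
        by (subst sum.swap) (simp add: f_def sum_distrib_right)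
      also have "\<dots> = (\<Sum>R\<in>Pow {2..<n}. f R * g R + f (insert n R) * g (insert n R)
          + (f (insert 1 R) * g (insert 1 R) + f (insert 1 (insert n R)) * g (insert 1 (insert n R))))"
        using n2 unfolding range by (simp add: sum_Pow_insert sum.distrib)
      also have "\<dots> = (\<Sum>R\<in>Pow {2..<n}. of_bool (R \<subseteq> J \<union> Suc ` J) * r R * 2 ^ card (set_mset M))"
      proof (intro sum.cong refl)
        fix R assume R: "R \<in> Pow {2..<n}"
        have "\<not> cyc_sparse n (insert 1 (insert n R))" unfolding cyc_sparse_def by auto
        then have "f (insert 1 (insert n R)) = 0" using supp by blast
        moreover have "R - {1, n} = R" "insert 1 R - {1, n} = R" "insert n R - {1, n} = R"
          using R by auto
        ultimately show "f R * g R + f (insert n R) * g (insert n R)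
            + (f (insert 1 R) * g (insert 1 R) + f (insert 1 (insert n R)) * g (insert 1 (insert n R)))
          = of_bool (R \<subseteq> J \<union> Suc ` J) * r R * 2 ^ card (set_mset M)"
          using R unfolding g_def r_def by (simp add: algebra_simps)
      qed
      finally show ?thesis by (simp flip: sum_distrib_right)
    qed
    have r_supp: "R \<subseteq> {2..<n} \<and> (\<forall>x\<in>R. Suc x \<notin> R)" if "r R \<noteq> 0" for R
    proof -
      have R: "R \<subseteq> {2..<n}" using that by (auto simp: r_def split: if_splits)
      have "f R \<noteq> 0 \<or> f (insert 1 R) \<noteq> 0 \<or> f (insert n R) \<noteq> 0"
        using that R unfolding r_def by auto
      then obtain U where "R \<subseteq> U" "f U \<noteq> 0" by blast
      have "Suc x \<notin> R" if x: "x \<in> R" for x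
      proof -
        have "x \<in> U" "x mod n + 1 = Suc x" using \<open>R \<subseteq> U\<close> subsetD[OF R x] x by auto
        then have "Suc x \<notin> U" using supp[OF \<open>f U \<noteq> 0\<close>] unfolding cyc_sparse_def by metis
        then show ?thesis using \<open>R \<subseteq> U\<close> by blast
      qed
      with R show ?thesis by blast
    qed
    have "f (cPk p\<^sub>0) = 0"
    proof (rule shift_invariant_vanishes[of n f])
      show "f R + f (insert 1 R) + f (insert n R) = 0" if "R \<subseteq> {2..<n}" for R
        using peak_coefficients_determined[of r n R, OF r_supp r_rel] that by (simp add: r_def)
    qed (use n2 inv supp cPk_subset[of "p\<^sub>0"] n_def in auto)
    moreover have "f (cPk p\<^sub>0) = a p\<^sub>0 * of_nat (count (cPk_cyc (cyc p\<^sub>0)) (cPk p\<^sub>0))"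
    proof -
      have "count (cPk_cyc (cyc p)) (cPk p\<^sub>0) = 0" if p: "p \<in> P'" "p \<noteq> p\<^sub>0" for p
      proof (rule ccontr)
        assume "count (cPk_cyc (cyc p)) (cPk p\<^sub>0) \<noteq> 0"
        then obtain q where q: "q \<in> cyc p" "cPk q = cPk p\<^sub>0" using countD p(1) by blast
        then have "q \<in> perms" "length q = n" using cyc_permsD P'D[OF p(1)] by auto
        then have "cPk_cyc (cyc q) = cPk_cyc (cyc p\<^sub>0)"
          using cPk_cyc_eq[of q "p\<^sub>0"] q(2) P'D[OF P'(2)] by simp
        then have "p = p\<^sub>0"
          using cyc_eq[OF q(1)] inj[of p "p\<^sub>0"] p(1) P'(2) by (auto simp: P'_def)
        with p(2) show False by simp
      qed
      then have "f (cPk p\<^sub>0) = (\<Sum>p\<in>P'. if p = p\<^sub>0 then a p\<^sub>0 * of_nat (count (cPk_cyc (cyc p\<^sub>0)) (cPk p\<^sub>0)) else 0)"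
        unfolding f_def by (intro sum.cong refl) auto
      then show ?thesis using P' by simp
    qed
    moreover have "count (cPk_cyc (cyc p\<^sub>0)) (cPk p\<^sub>0) \<noteq> 0"
    proof -
      have perm: "p\<^sub>0 \<in> perms" using P'D(1)[OF P'(2)] .
      have "p\<^sub>0 \<in> {q \<in> cyc p\<^sub>0. cPk q = cPk p\<^sub>0}" using self_in_cyc by simp
      moreover have "finite {q \<in> cyc p\<^sub>0. cPk q = cPk p\<^sub>0}" using finite_cyc[OF perm] by simp
      ultimately show ?thesis unfolding count_cPk_cyc[OF perm] card_eq_0_iff by blast
    qed
    ultimately show ?thesis by simp
  qed
qed

section \<open>The algebra of power series\<close>

text \<open>
  Every algebra law is an identity that can be checked after applying \<open>h\<close>.  Additive inverses are not given in advance but are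
  available as scalar multiples by \<open>- 1\<close>.
\<close>

lemma algebra_of_injective_hom:
  assumes B: "algebra R B"
    and h: "inj_on h (carrier A)" "h ` carrier A \<subseteq> carrier B"
    and closed: "\<one>\<^bsub>A\<^esub> \<in> carrier A" "\<zero>\<^bsub>A\<^esub> \<in> carrier A"
      "\<And>x y. x \<in> carrier A \<Longrightarrow> y \<in> carrier A \<Longrightarrow> x \<otimes>\<^bsub>A\<^esub> y \<in> carrier A"
      "\<And>x y. x \<in> carrier A \<Longrightarrow> y \<in> carrier A \<Longrightarrow> x \<oplus>\<^bsub>A\<^esub> y \<in> carrier A"
      "\<And>r x. r \<in> carrier R \<Longrightarrow> x \<in> carrier A \<Longrightarrow> r \<odot>\<^bsub>A\<^esub> x \<in> carrier A"
    and hom: "h \<one>\<^bsub>A\<^esub> = \<one>\<^bsub>B\<^esub>" "h \<zero>\<^bsub>A\<^esub> = \<zero>\<^bsub>B\<^esub>"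
      "\<And>x y. x \<in> carrier A \<Longrightarrow> y \<in> carrier A \<Longrightarrow> h (x \<otimes>\<^bsub>A\<^esub> y) = h x \<otimes>\<^bsub>B\<^esub> h y"
      "\<And>x y. x \<in> carrier A \<Longrightarrow> y \<in> carrier A \<Longrightarrow> h (x \<oplus>\<^bsub>A\<^esub> y) = h x \<oplus>\<^bsub>B\<^esub> h y"
      "\<And>r x. r \<in> carrier R \<Longrightarrow> x \<in> carrier A \<Longrightarrow> h (r \<odot>\<^bsub>A\<^esub> x) = r \<odot>\<^bsub>B\<^esub> h x"
  shows "algebra R A"
proof -
  interpret B: algebra R B by (rule B)
  have hB: "h x \<in> carrier B" if "x \<in> carrier A" for x using that h(2) by blast
  have eq: "x = y" if "h x = h y" "x \<in> carrier A" "y \<in> carrier A" for x y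
    using h(1) that by (auto simp: inj_on_def)
  note simps = closed hom hB
  have "cring A"
  proof (rule cringI)
    show "abelian_group A"
    proof (rule abelian_groupI)
      fix x assume x: "x \<in> carrier A"
      define y where "y = (\<ominus>\<^bsub>R\<^esub> \<one>\<^bsub>R\<^esub>) \<odot>\<^bsub>A\<^esub> x"
      have y: "y \<in> carrier A" using x by (simp add: y_def closed)
      have "h (y \<oplus>\<^bsub>A\<^esub> x) = (\<ominus>\<^bsub>R\<^esub> \<one>\<^bsub>R\<^esub>) \<odot>\<^bsub>B\<^esub> h x \<oplus>\<^bsub>B\<^esub> \<one>\<^bsub>R\<^esub> \<odot>\<^bsub>B\<^esub> h x"
        using x y by (simp add: simps y_def)
      also have "\<dots> = \<zero>\<^bsub>B\<^esub>"
        using hB[OF x] by (subst B.smult_l_distr[symmetric]) (simp_all add: B.R.l_neg)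
      finally have "y \<oplus>\<^bsub>A\<^esub> x = \<zero>\<^bsub>A\<^esub>" using x y by (intro eq) (simp_all add: simps)
      with y show "\<exists>y\<in>carrier A. y \<oplus>\<^bsub>A\<^esub> x = \<zero>\<^bsub>A\<^esub>" by blast
    qed (auto intro!: eq simp: simps B.a_ac)
    show "Group.comm_monoid A"
      by (rule comm_monoidI) (auto intro!: eq simp: simps B.m_ac)
  qed (auto intro!: eq simp: simps B.l_distr)
  then show ?thesis
    by (rule algebraI[OF B.R.is_cring])
      (auto intro!: eq simp: simps B.smult_l_distr B.smult_r_distr B.smult_assoc1 B.smult_assoc2)
qed

lemma conv_commute: "conv f g = conv g f"
proof
  fix M
  show "conv f g M = conv g f M"
    unfolding conv_def
    by (rule sum.reindex_bij_witness[of _ prod.swap prod.swap]) (auto simp: add.commute mult.commute)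
qed

lemma conv_assoc: "conv (conv f g) h = conv f (conv g h)"
proof
  fix M
  have "conv (conv f g) h M =
      (\<Sum>x\<in>splittings M. \<Sum>y\<in>splittings (fst x). f (fst y) * g (snd y) * h (snd x))"
    by (simp add: conv_def case_prod_beta sum_distrib_right)
  also have "\<dots> = (\<Sum>(x, y)\<in>Sigma (splittings M) (\<lambda>x. splittings (fst x)).
      f (fst y) * g (snd y) * h (snd x))"
    by (rule sum.Sigma) (auto simp: finite_splittings)
  also have "\<dots> = (\<Sum>(x, y)\<in>Sigma (splittings M) (\<lambda>x. splittings (snd x)).
      f (fst x) * (g (fst y) * h (snd y)))"
    by (rule sum.reindex_bij_witness[of _ "\<lambda>((A, E), (B, C)). ((A + B, C), (A, B))"
          "\<lambda>((D, C), (A, B)). ((A, B + C), (B, C))"]) (auto simp: add.assoc mult.assoc)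
  also have "\<dots> = (\<Sum>x\<in>splittings M. \<Sum>y\<in>splittings (snd x). f (fst x) * (g (fst y) * h (snd y)))"
    by (rule sum.Sigma[symmetric]) (auto simp: finite_splittings)
  also have "\<dots> = conv f (conv g h) M"
    by (simp add: conv_def case_prod_beta sum_distrib_left)
  finally show "conv (conv f g) h M = conv f (conv g h) M" .
qed

lemma conv_one: "conv series_one g = g"
proof
  fix M
  have "conv series_one g M = (\<Sum>x\<in>splittings M. if x = ({#}, M) then g M else 0)"
    unfolding conv_def by (intro sum.cong) (auto simp: series_one_def)
  also have "\<dots> = g M" using finite_splittings by simp
  finally show "conv series_one g M = g M" .
qed

lemma conv_add: "conv (\<lambda>M. f M + g M) h = (\<lambda>M. conv f h M + conv g h M)"
  by (rule ext) (simp add: conv_def case_prod_beta distrib_right sum.distrib)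

lemma conv_smult: "conv (\<lambda>M. r * f M) h = (\<lambda>M. r * conv f h M)"
  by (rule ext) (simp add: conv_def case_prod_beta sum_distrib_left mult.assoc)

lemma series_algebra_simps:
  "carrier series_algebra = UNIV" "f \<otimes>\<^bsub>series_algebra\<^esub> g = conv f g"
  "\<one>\<^bsub>series_algebra\<^esub> = series_one" "\<zero>\<^bsub>series_algebra\<^esub> = (\<lambda>M. 0)"
  "f \<oplus>\<^bsub>series_algebra\<^esub> g = (\<lambda>M. f M + g M)" "r \<odot>\<^bsub>series_algebra\<^esub> f = (\<lambda>M. r * f M)"
  by (auto simp: series_algebra_def conv_def)

lemma cring_rat_ring: "cring rat_ring"
  by (rule cring_from_type_algebra)

lemma rat_ring_simps:
  "carrier rat_ring = UNIV" "r \<oplus>\<^bsub>rat_ring\<^esub> s = r + s" "r \<otimes>\<^bsub>rat_ring\<^esub> s = r * s" "\<one>\<^bsub>rat_ring\<^esub> = 1"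
  by (simp_all add: ring_of_type_algebra_def)

lemma algebra_series: "algebra rat_ring series_algebra"
proof (rule algebraI)
  show "cring series_algebra"
  proof (rule cringI)
    show "abelian_group series_algebra"
    proof (rule abelian_groupI)
      fix f :: series
      show "\<exists>g\<in>carrier series_algebra. g \<oplus>\<^bsub>series_algebra\<^esub> f = \<zero>\<^bsub>series_algebra\<^esub>"
        by (rule bexI[of _ "\<lambda>M. - f M"]) (auto simp: series_algebra_simps)
    qed (auto simp: series_algebra_simps add.assoc add.commute)
    show "Group.comm_monoid series_algebra"
      by (rule comm_monoidI)
        (auto simp: series_algebra_simps conv_assoc conv_one intro: conv_commute)
  qed (auto simp: series_algebra_simps conv_add)
qed (auto simp: series_algebra_simps rat_ring_simps conv_smult cring_rat_ring algebra_simps)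

section \<open>The isomorphism\<close>

abbreviation cPk_class :: "nat list \<Rightarrow> nat list set set" where
  "cPk_class p \<equiv> cyc_class cPk_cyc (cyc p)"

abbreviation cPk_classes :: "nat list set set set" where
  "cPk_classes \<equiv> cyc_class cPk_cyc ` cyclic_perms"

lemma cPk_classes_eq: "cPk_classes = cPk_class ` perms"
  by (auto simp: cyclic_perms_def)

lemma cPk_class_eq_iff:
  assumes "p \<in> perms" "q \<in> perms"
  shows "cPk_class p = cPk_class q \<longleftrightarrow> length p = length q \<and> cPk_cyc (cyc p) = cPk_cyc (cyc q)"
proof
  assume "cPk_class p = cPk_class q"
  moreover have "cyc p \<in> cPk_class p" using assms by (auto simp: cyc_class_def cyclic_perms_def)
  ultimately have "cyc p \<in> cPk_class q" by simp
  then show "length p = length q \<and> cPk_cyc (cyc p) = cPk_cyc (cyc q)"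
    using assms by (simp add: cyc_class_def cyc_length_cyc)
qed (use assms in \<open>simp add: cyc_class_def cyc_length_cyc\<close>)

lemma mem_cPk_class_iff:
  assumes "p \<in> perms" "q \<in> perms"
  shows "cyc q \<in> cPk_class p \<longleftrightarrow> cPk_class q = cPk_class p"
  using assms cPk_class_eq_iff[OF assms(2,1)]
  by (auto simp: cyc_class_def cyc_length_cyc cyclic_perms_def)

text \<open>
  A cyclic peak function is a sum over the multiset of cyclic peak sets of all rotations, that is, over the value of
  the statistic.
\<close>

lemma cyc_peak_fun_cPk_cong:
  assumes "p \<in> perms" "q \<in> perms" "cPk_class p = cPk_class q"
  shows "cyc_peak_fun (length p) (cPk p) = cyc_peak_fun (length q) (cPk q)"
proof
  fix M
  have eq: "cyc_peak_fun (length r) (cPk r) M =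
      sum_mset (image_mset (\<lambda>S. peak_fun (length r) (S - {1, length r}) M) (cPk_cyc (cyc r)))"
    if "r \<in> perms" for r
    unfolding cyc_peak_fun_eq_sum[OF that refl] cPk_cyc_def
    by (simp add: sum_unfold_sum_mset image_mset.compositionality comp_def)
  show "cyc_peak_fun (length p) (cPk p) M = cyc_peak_fun (length q) (cPk q) M"
    unfolding eq[OF assms(1)] eq[OF assms(2)]
    using assms(3) cPk_class_eq_iff[OF assms(1,2)] by simp
qed

definition class_fun :: "nat list set set \<Rightarrow> series" where
  "class_fun C = (let p = SOME p. p \<in> perms \<and> C = cPk_class p in cyc_peak_fun (length p) (cPk p))"

lemma class_fun_cPk_class:
  assumes "p \<in> perms"
  shows "class_fun (cPk_class p) = cyc_peak_fun (length p) (cPk p)"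
proof -
  define q where "q = (SOME q. q \<in> perms \<and> cPk_class p = cPk_class q)"
  have "q \<in> perms \<and> cPk_class p = cPk_class q"
    unfolding q_def using assms by (rule_tac someI[of _ p]) simp
  then show ?thesis
    using cyc_peak_fun_cPk_cong[OF assms, of q]
    unfolding class_fun_def Let_def q_def[symmetric] by simp
qed

definition to_series :: "(nat list set set \<Rightarrow>\<^sub>0 rat) \<Rightarrow> series" where
  "to_series a M = (\<Sum>C\<in>Poly_Mapping.keys a. Poly_Mapping.lookup a C * class_fun C M)"

lemma to_series_superset:
  assumes "finite F" "Poly_Mapping.keys a \<subseteq> F"
  shows "to_series a M = (\<Sum>C\<in>F. Poly_Mapping.lookup a C * class_fun C M)"
  unfolding to_series_def
  by (rule sum.mono_neutral_left) (use assms in \<open>auto simp: in_keys_iff\<close>)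

lemma to_series_add: "to_series (a + b) M = to_series a M + to_series b M"
proof -
  let ?F = "Poly_Mapping.keys a \<union> Poly_Mapping.keys b"
  have "to_series (a + b) M = (\<Sum>C\<in>?F. Poly_Mapping.lookup (a + b) C * class_fun C M)"
    using Poly_Mapping.keys_add[of a b] by (intro to_series_superset) auto
  then show ?thesis
    using to_series_superset[of ?F a] to_series_superset[of ?F b]
    by (simp add: lookup_add distrib_right sum.distrib)
qed

lemma lookup_smult: "Poly_Mapping.lookup (Poly_Mapping.map ((*) r) a) C = (r::rat) * Poly_Mapping.lookup a C"
  by (simp add: Poly_Mapping.map.rep_eq when_def)

lemma keys_smult: "Poly_Mapping.keys (Poly_Mapping.map ((*) (r::rat)) a) \<subseteq> Poly_Mapping.keys a"
  by (auto simp: in_keys_iff lookup_smult)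

lemma to_series_smult: "to_series (Poly_Mapping.map ((*) r) a) M = r * to_series a M"
proof -
  have "to_series (Poly_Mapping.map ((*) r) a) M
      = (\<Sum>C\<in>Poly_Mapping.keys a. Poly_Mapping.lookup (Poly_Mapping.map ((*) r) a) C * class_fun C M)"
    by (intro to_series_superset keys_smult) simp
  then show ?thesis by (simp add: lookup_smult to_series_def sum_distrib_left mult.assoc)
qed

lemma to_series_zero: "to_series 0 M = 0"
  by (simp add: to_series_def)

lemma to_series_basis: "to_series (basis C) = class_fun C"
  by (rule ext) (simp add: to_series_def)

lemma to_series_sum: "to_series (\<Sum>i\<in>I. g i) M = (\<Sum>i\<in>I. to_series (g i) M)"
  by (induction I rule: infinite_finite_induct) (simp_all add: to_series_zero to_series_add)

lemma carrier_cyc_algebra: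
  "carrier (cyc_algebra cPk_cyc) = {a. Poly_Mapping.keys a \<subseteq> cPk_classes}"
  by (simp add: cyc_algebra_def)

lemma carrier_closed:
  "0 \<in> carrier (cyc_algebra cPk_cyc)"
  "a \<in> carrier (cyc_algebra cPk_cyc) \<Longrightarrow> b \<in> carrier (cyc_algebra cPk_cyc) \<Longrightarrow>
     a + b \<in> carrier (cyc_algebra cPk_cyc)"
  "a \<in> carrier (cyc_algebra cPk_cyc) \<Longrightarrow> Poly_Mapping.map ((*) r) a \<in> carrier (cyc_algebra cPk_cyc)"
  "p \<in> perms \<Longrightarrow> basis (cPk_class p) \<in> carrier (cyc_algebra cPk_cyc)"
  unfolding carrier_cyc_algebra cPk_classes_eq
  using Poly_Mapping.keys_add[of a b] keys_smult[of r a] by auto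

lemma carrier_sum_closed:
  "(\<And>i. i \<in> I \<Longrightarrow> g i \<in> carrier (cyc_algebra cPk_cyc)) \<Longrightarrow>
    (\<Sum>i\<in>I. g i) \<in> carrier (cyc_algebra cPk_cyc)"
  by (induction I rule: infinite_finite_induct) (auto intro: carrier_closed)

text \<open>
  Choosing one permutation from each class turns a linear relation among the series of distinct classes into one
  covered by \<open>cyc_peak_fun_independent\<close>.
\<close>

lemma to_series_eq_0:
  assumes "a \<in> carrier (cyc_algebra cPk_cyc)" "\<And>M. to_series a M = 0"
  shows "a = 0"
proof (rule ccontr)
  assume "a \<noteq> 0"
  then obtain C\<^sub>0 where C0: "C\<^sub>0 \<in> Poly_Mapping.keys a" by (metis keys_eq_empty ex_in_conv)
  define rep where "rep C = (SOME p. p \<in> perms \<and> C = cPk_class p)" for C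
  have rep: "rep C \<in> perms" "cPk_class (rep C) = C" if "C \<in> Poly_Mapping.keys a" for C
  proof -
    have "\<exists>p. p \<in> perms \<and> C = cPk_class p"
      using that assms(1) unfolding carrier_cyc_algebra cPk_classes_eq by auto
    from someI_ex[OF this] show "rep C \<in> perms" "cPk_class (rep C) = C" by (simp_all add: rep_def)
  qed
  have inj: "inj_on rep (Poly_Mapping.keys a)" using rep(2) by (metis inj_onI)
  have "Poly_Mapping.lookup a (cPk_class (rep C\<^sub>0)) = 0"
  proof (rule cyc_peak_fun_independent[of "rep ` Poly_Mapping.keys a"
        "\<lambda>p. Poly_Mapping.lookup a (cPk_class p)"])
    fix p q assume "p \<in> rep ` Poly_Mapping.keys a" "q \<in> rep ` Poly_Mapping.keys a"
      "length p = length q" "cPk_cyc (cyc p) = cPk_cyc (cyc q)"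
    moreover from this have "cPk_class p = cPk_class q"
      using rep(1) by (subst cPk_class_eq_iff) auto
    ultimately show "p = q" using rep(2) by auto
  next
    fix M
    have "(\<Sum>p\<in>rep ` Poly_Mapping.keys a.
        Poly_Mapping.lookup a (cPk_class p) * cyc_peak_fun (length p) (cPk p) M) = to_series a M"
      unfolding to_series_def using rep class_fun_cPk_class
      by (simp add: sum.reindex[OF inj]) (intro sum.cong, auto, metis)
    then show "(\<Sum>p\<in>rep ` Poly_Mapping.keys a.
        Poly_Mapping.lookup a (cPk_class p) * cyc_peak_fun (length p) (cPk p) M) = 0"
      using assms(2) by simp
  qed (use rep(1) C0 in auto)
  with C0 rep(2)[OF C0] show False by (simp add: in_keys_iff)
qed

lemma inj_on_to_series: "inj_on to_series (carrier (cyc_algebra cPk_cyc))"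
proof (rule inj_onI)
  fix a b assume ab: "a \<in> carrier (cyc_algebra cPk_cyc)" "b \<in> carrier (cyc_algebra cPk_cyc)"
    and eq: "to_series a = to_series b"
  define d where "d = a + Poly_Mapping.map ((*) (-1)) b"
  have "d = 0"
  proof (rule to_series_eq_0)
    show "d \<in> carrier (cyc_algebra cPk_cyc)" unfolding d_def by (intro carrier_closed ab)
    show "to_series d M = 0" for M by (simp add: d_def to_series_add to_series_smult eq)
  qed
  then have "Poly_Mapping.lookup d C = 0" for C by simp
  then have "Poly_Mapping.lookup a C = Poly_Mapping.lookup b C" for C
    by (simp add: d_def lookup_add lookup_smult)
  then show "a = b" by (rule poly_mapping_eqI)
qed

lemma to_series_shuffle_sum:
  assumes "p \<in> perms" "q \<in> perms" "set p \<inter> set q = {}"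
  shows "to_series (\<Sum>t\<in>cSh (cyc p) (cyc q). basis (cyc_class cPk_cyc t))
    = conv (class_fun (cPk_class p)) (class_fun (cPk_class q))"
proof
  fix M
  have "class_fun (cyc_class cPk_cyc t) M = of_nat (card (enriched t M))"
    if t: "t \<in> cSh (cyc p) (cyc q)" for t
  proof -
    obtain u where "t = cyc u" "u \<in> perms"
      using cSh_memD(1)[OF assms(1,2) t] by (auto simp: cyclic_perms_def)
    then show ?thesis by (simp add: class_fun_cPk_class cyc_peak_fun_eq_card)
  qed
  then show "to_series (\<Sum>t\<in>cSh (cyc p) (cyc q). basis (cyc_class cPk_cyc t)) M
    = conv (class_fun (cPk_class p)) (class_fun (cPk_class q)) M"
    using cyc_peak_fun_mult[OF assms, of M] class_fun_cPk_class assms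
    by (simp add: to_series_sum to_series_basis)
qed

lemma shuffle_sum_carrier:
  assumes "p \<in> perms" "q \<in> perms"
  shows "(\<Sum>t\<in>cSh (cyc p) (cyc q). basis (cyc_class cPk_cyc t)) \<in> carrier (cyc_algebra cPk_cyc)"
proof (rule carrier_sum_closed)
  fix t assume "t \<in> cSh (cyc p) (cyc q)"
  then obtain u where "t = cyc u" "u \<in> perms"
    using cSh_memD(1)[OF assms] by (auto simp: cyclic_perms_def)
  then show "basis (cyc_class cPk_cyc t) \<in> carrier (cyc_algebra cPk_cyc)"
    by (simp add: carrier_closed)
qed

text \<open>
  The formal sum of the classes of all cyclic shuffles has an image that depends only on the classes of the factors.
  By injectivity the formal sum itself depends only on these classes, and its coefficients are the multiplicities
  of the values of the statistic.
\<close>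

theorem cyclic_shuffle_compatible_cPk_cyc: "cyclic_shuffle_compatible cPk_cyc"
  unfolding cyclic_shuffle_compatible_def
proof (intro conjI ballI impI)
  show "cyclic_statistic cPk_cyc" by (rule cyclic_statistic_cPk_cyc)
  fix c d c' d' assume "c \<in> cyclic_perms" "d \<in> cyclic_perms" "c' \<in> cyclic_perms" "d' \<in> cyclic_perms"
    and disj: "cyc_disjoint c d" "cyc_disjoint c' d'"
    and cst: "cPk_cyc c = cPk_cyc c'" "cPk_cyc d = cPk_cyc d'"
    and len: "cyc_length c = cyc_length c'" "cyc_length d = cyc_length d'"
  then obtain p q p' q' where perms: "p \<in> perms" "q \<in> perms" "p' \<in> perms" "q' \<in> perms"
    and c: "c = cyc p" "d = cyc q" "c' = cyc p'" "d' = cyc q'"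
    unfolding cyclic_perms_def by blast
  have disj': "set p \<inter> set q = {}" "set p' \<inter> set q' = {}"
    using disj perms by (simp_all add: c cyc_disjoint_cyc)
  have len': "length p = length p'" "length q = length q'"
    using len perms by (simp_all add: c cyc_length_cyc)
  have cl: "cPk_class p = cPk_class p'" "cPk_class q = cPk_class q'"
    using perms len' cst by (simp_all add: cPk_class_eq_iff c)
  let ?s = "\<lambda>c d. \<Sum>t\<in>cSh c d. basis (cyc_class cPk_cyc t)"
  have "to_series (?s c d) = to_series (?s c' d')"
    unfolding c by (simp only: to_series_shuffle_sum perms disj' cl)
  then have eq: "?s c d = ?s c' d'"
    using inj_on_to_series shuffle_sum_carrier perms unfolding c by (meson inj_onD)
  \<comment> \<open>All cyclic shuffles have the same length, so their classes correspond to the values of the statistic.\<close>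
  define N where "N = length p + length q"
  have count: "of_nat (count (image_mset cPk_cyc (mset_set (cSh (cyc u) (cyc v)))) s)
      = Poly_Mapping.lookup (?s (cyc u) (cyc v)) {e \<in> cyclic_perms. cPk_cyc e = s \<and> cyc_length e = N}"
    if uv: "u \<in> perms" "v \<in> perms" "set u \<inter> set v = {}" "length u + length v = N" for u v s
  proof -
    let ?E = "{e \<in> cyclic_perms. cPk_cyc e = s \<and> cyc_length e = N}"
    note fin = finite_cSh[OF uv(1-3)]
    have "cyc_class cPk_cyc t = ?E \<longleftrightarrow> cPk_cyc t = s" if "t \<in> cSh (cyc u) (cyc v)" for t
      using cSh_memD[OF uv(1,2) that] uv(4) unfolding cyc_class_def by auto
    then have "Poly_Mapping.lookup (?s (cyc u) (cyc v)) ?E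
        = (\<Sum>t\<in>cSh (cyc u) (cyc v). of_bool (cPk_cyc t = s))"
      unfolding lookup_sum by (intro sum.cong refl) (simp add: lookup_single when_def)
    also have "\<dots> = of_nat (card {t \<in> cSh (cyc u) (cyc v). cPk_cyc t = s})"
      using fin by (simp add: sum_of_bool_eq Int_def)
    also have "{t \<in> cSh (cyc u) (cyc v). cPk_cyc t = s} = cPk_cyc -` {s} \<inter> cSh (cyc u) (cyc v)"
      by auto
    also have "card \<dots> = count (image_mset cPk_cyc (mset_set (cSh (cyc u) (cyc v)))) s"
      using fin by (simp add: count_image_mset)
    finally show ?thesis ..
  qed
  show "image_mset cPk_cyc (mset_set (cSh c d)) = image_mset cPk_cyc (mset_set (cSh c' d'))"
  proof (rule multiset_eqI)
    fix s
    have "(of_nat (count (image_mset cPk_cyc (mset_set (cSh c d))) s) :: rat)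
        = of_nat (count (image_mset cPk_cyc (mset_set (cSh c' d'))) s)"
      using count[of p q s] count[of p' q' s] perms disj' len' eq by (simp add: c N_def)
    then show "count (image_mset cPk_cyc (mset_set (cSh c d))) s
        = count (image_mset cPk_cyc (mset_set (cSh c' d'))) s" by simp
  qed
qed

text \<open>
  The representatives that define the product of two classes exist: adding a large number to all letters of a permutation
  keeps its class and makes it disjoint from another one.
\<close>

lemma class_mult_eq:
  assumes "C \<in> cPk_classes" "D \<in> cPk_classes"
  shows "\<exists>p\<in>perms. \<exists>q\<in>perms. set p \<inter> set q = {} \<and> C = cPk_class p \<and> D = cPk_class q \<and>
    class_mult cPk_cyc C D = (\<Sum>t\<in>cSh (cyc p) (cyc q). basis (cyc_class cPk_cyc t))"
proof -
  obtain p q where p: "p \<in> perms" "C = cPk_class p" and q: "q \<in> perms" "D = cPk_class q"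
    using assms unfolding cPk_classes_eq by blast
  let ?P = "\<lambda>(c, d). c \<in> C \<and> d \<in> D \<and> cyc_disjoint c d"
  define r where "r = map (\<lambda>x. x + sum_list p) q"
  have r: "r \<in> perms" using q(1) by (auto simp: r_def perms_def distinct_map inj_on_def)
  have "cPk r = cPk q" by (rule cPk_cong) (simp_all add: r_def)
  then have "cPk_class r = D"
    using q r cPk_cyc_eq[OF r q(1)] by (simp add: cPk_class_eq_iff r_def)
  moreover have "set p \<inter> set r = {}"
  proof -
    have "x \<le> sum_list p" if "x \<in> set p" for x using that by (simp add: member_le_sum_list)
    moreover have "0 < y" if "y \<in> set q" for y using that q(1) unfolding perms_def by (auto intro!: gr0I)
    ultimately show ?thesis by (fastforce simp: r_def)
  qed
  ultimately have ex: "?P (cyc p, cyc r)"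
    using p r mem_cPk_class_iff[of p p] mem_cPk_class_iff[of r r] by (auto simp: cyc_disjoint_cyc)
  obtain c d where cd: "(SOME x. ?P x) = (c, d)" by fastforce
  have P: "c \<in> C" "d \<in> D" "cyc_disjoint c d"
    using someI[of ?P, OF ex] unfolding cd by auto
  obtain p' q' where p': "p' \<in> perms" "c = cyc p'" and q': "q' \<in> perms" "d = cyc q'"
    using P p q unfolding cyc_class_def cyclic_perms_def by blast
  have "C = cPk_class p'" "D = cPk_class q'"
    using P mem_cPk_class_iff[of p p'] mem_cPk_class_iff[of q q'] p q p' q' by auto
  moreover have "set p' \<inter> set q' = {}" using P(3) p' q' by (simp add: cyc_disjoint_cyc)
  moreover have "class_mult cPk_cyc C D = (\<Sum>t\<in>cSh (cyc p') (cyc q'). basis (cyc_class cPk_cyc t))"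
    unfolding class_mult_def cd by (simp add: p' q')
  ultimately show ?thesis using p'(1) q'(1) by blast
qed

lemma class_mult_series:
  assumes "C \<in> cPk_classes" "D \<in> cPk_classes"
  shows "class_mult cPk_cyc C D \<in> carrier (cyc_algebra cPk_cyc)"
    "to_series (class_mult cPk_cyc C D) = conv (class_fun C) (class_fun D)"
proof -
  obtain p q where pq: "p \<in> perms" "q \<in> perms" "set p \<inter> set q = {}"
    and C: "C = cPk_class p" and D: "D = cPk_class q"
    and eq: "class_mult cPk_cyc C D = (\<Sum>t\<in>cSh (cyc p) (cyc q). basis (cyc_class cPk_cyc t))"
    using class_mult_eq[OF assms] by blast
  show "class_mult cPk_cyc C D \<in> carrier (cyc_algebra cPk_cyc)"
    unfolding eq by (rule shuffle_sum_carrier[OF pq(1,2)])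
  show "to_series (class_mult cPk_cyc C D) = conv (class_fun C) (class_fun D)"
    by (rule to_series_shuffle_sum[OF pq, folded C D, folded eq])
qed

lemma cyc_algebra_simps:
  "a \<otimes>\<^bsub>cyc_algebra cst\<^esub> b = (\<Sum>C\<in>Poly_Mapping.keys a. \<Sum>D\<in>Poly_Mapping.keys b.
     Poly_Mapping.map ((*) (Poly_Mapping.lookup a C * Poly_Mapping.lookup b D)) (class_mult cst C D))"
  "\<one>\<^bsub>cyc_algebra cst\<^esub> = basis (cyc_class cst (cyc []))" "\<zero>\<^bsub>cyc_algebra cst\<^esub> = 0"
  "a \<oplus>\<^bsub>cyc_algebra cst\<^esub> b = a + b" "r \<odot>\<^bsub>cyc_algebra cst\<^esub> a = Poly_Mapping.map ((*) r) a"
  by (simp_all add: cyc_algebra_def)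

lemma
  assumes "a \<in> carrier (cyc_algebra cPk_cyc)" "b \<in> carrier (cyc_algebra cPk_cyc)"
  shows mult_carrier: "a \<otimes>\<^bsub>cyc_algebra cPk_cyc\<^esub> b \<in> carrier (cyc_algebra cPk_cyc)"
    and to_series_mult: "to_series (a \<otimes>\<^bsub>cyc_algebra cPk_cyc\<^esub> b) = conv (to_series a) (to_series b)"
proof -
  have mem: "C \<in> cPk_classes" "D \<in> cPk_classes"
    if "C \<in> Poly_Mapping.keys a" "D \<in> Poly_Mapping.keys b" for C D
    using that assms by (auto simp: carrier_cyc_algebra)
  show "a \<otimes>\<^bsub>cyc_algebra cPk_cyc\<^esub> b \<in> carrier (cyc_algebra cPk_cyc)"
    unfolding cyc_algebra_simps
    by (intro carrier_sum_closed carrier_closed class_mult_series mem)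
  show "to_series (a \<otimes>\<^bsub>cyc_algebra cPk_cyc\<^esub> b) = conv (to_series a) (to_series b)"
  proof
    fix M
    let ?a = "Poly_Mapping.lookup a" and ?b = "Poly_Mapping.lookup b"
    have "to_series (a \<otimes>\<^bsub>cyc_algebra cPk_cyc\<^esub> b) M = (\<Sum>C\<in>Poly_Mapping.keys a.
        \<Sum>D\<in>Poly_Mapping.keys b. ?a C * ?b D * to_series (class_mult cPk_cyc C D) M)"
      by (simp add: cyc_algebra_simps to_series_sum to_series_smult)
    also have "\<dots> = (\<Sum>C\<in>Poly_Mapping.keys a. \<Sum>D\<in>Poly_Mapping.keys b.
        \<Sum>x\<in>splittings M. (?a C * class_fun C (fst x)) * (?b D * class_fun D (snd x)))"
      using mem by (intro sum.cong refl)
        (simp add: class_mult_series conv_def case_prod_beta sum_distrib_left algebra_simps)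
    also have "\<dots> = (\<Sum>C\<in>Poly_Mapping.keys a. \<Sum>x\<in>splittings M. \<Sum>D\<in>Poly_Mapping.keys b.
        (?a C * class_fun C (fst x)) * (?b D * class_fun D (snd x)))"
      by (intro sum.cong refl sum.swap)
    also have "\<dots> = (\<Sum>x\<in>splittings M. \<Sum>C\<in>Poly_Mapping.keys a. \<Sum>D\<in>Poly_Mapping.keys b.
        (?a C * class_fun C (fst x)) * (?b D * class_fun D (snd x)))"
      by (rule sum.swap)
    also have "\<dots> = conv (to_series a) (to_series b) M"
      by (simp add: conv_def to_series_def case_prod_beta sum_product)
    finally show "to_series (a \<otimes>\<^bsub>cyc_algebra cPk_cyc\<^esub> b) M = conv (to_series a) (to_series b) M" .
  qed
qed

lemma Nil_in_perms: "[] \<in> perms"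
  by (simp add: perms_def)

lemma to_series_one: "to_series \<one>\<^bsub>cyc_algebra cPk_cyc\<^esub> = series_one"
  using class_fun_cPk_class[OF Nil_in_perms]
  by (simp add: cyc_algebra_simps to_series_basis cyc_peak_fun_def)

text \<open>
  A linear combination of cyclic peak functions is indexed by a set of series, whereas an element of the
  shuffle algebra is indexed by classes.  For the inclusion from right to left the indices correspond because distinct classes
  have distinct series.
\<close>

lemma carrier_cyc_peak_algebra:
  "carrier cyc_peak_algebra = to_series ` carrier (cyc_algebra cPk_cyc)"
proof (intro subset_antisym subsetI)
  fix f assume "f \<in> carrier cyc_peak_algebra"
  then obtain G r where G: "finite G" "G \<subseteq> {cyc_peak_fun n S | n S. S \<in> cyclic_peak_sets n}"
    and f: "f = (\<lambda>M. \<Sum>g\<in>G. r g * g M)"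
    by (auto simp: cyc_peak_algebra_def)
  have "\<forall>g\<in>G. \<exists>p. p \<in> perms \<and> g = cyc_peak_fun (length p) (cPk p)"
    using G(2) by (fastforce simp: cyclic_peak_sets_def)
  then obtain P where P: "\<And>g. g \<in> G \<Longrightarrow> P g \<in> perms \<and> g = cyc_peak_fun (length (P g)) (cPk (P g))"
    by metis
  define a where "a = (\<Sum>g\<in>G. Poly_Mapping.map ((*) (r g)) (basis (cPk_class (P g))))"
  have "a \<in> carrier (cyc_algebra cPk_cyc)"
    unfolding a_def using P by (intro carrier_sum_closed carrier_closed) auto
  moreover have "to_series a = f"
  proof
    fix M
    have "class_fun (cPk_class (P g)) = g" if "g \<in> G" for g
      using P[OF that] class_fun_cPk_class by metis
    then show "to_series a M = f M"
      by (simp add: a_def f to_series_sum to_series_smult to_series_basis del: map_single)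
  qed
  ultimately show "f \<in> to_series ` carrier (cyc_algebra cPk_cyc)" by blast
next
  fix f assume "f \<in> to_series ` carrier (cyc_algebra cPk_cyc)"
  then obtain a where a: "a \<in> carrier (cyc_algebra cPk_cyc)" "f = to_series a" by blast
  let ?K = "Poly_Mapping.keys a"
  have K: "\<exists>p\<in>perms. C = cPk_class p" if "C \<in> ?K" for C
    using a(1) that unfolding carrier_cyc_algebra cPk_classes_eq by blast
  have inj: "inj_on class_fun ?K"
  proof (rule inj_onI)
    fix C D assume CD: "C \<in> ?K" "D \<in> ?K" "class_fun C = class_fun D"
    have "basis C \<in> carrier (cyc_algebra cPk_cyc)" "basis D \<in> carrier (cyc_algebra cPk_cyc)"
      using K[OF CD(1)] K[OF CD(2)] carrier_closed(4) by auto
    then have "(basis C :: _ \<Rightarrow>\<^sub>0 rat) = basis D"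
      using CD(3) inj_on_to_series by (simp add: inj_on_def to_series_basis)
    then show "C = D" using lookup_single_eq[of C "1::rat"] by (metis lookup_single_not_eq zero_neq_one)
  qed
  have f: "f = (\<lambda>M. \<Sum>g\<in>class_fun ` ?K. Poly_Mapping.lookup a (the_inv_into ?K class_fun g) * g M)"
    by (rule ext) (simp add: a(2) to_series_def sum.reindex[OF inj] the_inv_into_f_f[OF inj])
  have sub: "class_fun ` ?K \<subseteq> {cyc_peak_fun n S | n S. S \<in> cyclic_peak_sets n}"
  proof clarify
    fix C assume "C \<in> ?K"
    then obtain p where "p \<in> perms" "C = cPk_class p" using K by blast
    then show "\<exists>n S. class_fun C = cyc_peak_fun n S \<and> S \<in> cyclic_peak_sets n"
      using class_fun_cPk_class[of p] by (auto simp: cyclic_peak_sets_def)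
  qed
  have "carrier cyc_peak_algebra = {f. \<exists>G r. finite G \<and>
      G \<subseteq> {cyc_peak_fun n S | n S. S \<in> cyclic_peak_sets n} \<and> f = (\<lambda>M. \<Sum>g\<in>G. r g * g M)}"
    by (simp add: cyc_peak_algebra_def)
  then show "f \<in> carrier cyc_peak_algebra"
    by (simp only: mem_Collect_eq) (intro exI conjI, rule finite_imageI[OF finite_keys], rule sub, rule f)
qed

lemma cyc_peak_algebra_simps:
  "f \<otimes>\<^bsub>cyc_peak_algebra\<^esub> g = conv f g"
  "\<one>\<^bsub>cyc_peak_algebra\<^esub> = series_one" "\<zero>\<^bsub>cyc_peak_algebra\<^esub> = (\<lambda>M. 0)"
  "f \<oplus>\<^bsub>cyc_peak_algebra\<^esub> g = (\<lambda>M. f M + g M)" "r \<odot>\<^bsub>cyc_peak_algebra\<^esub> f = (\<lambda>M. r * f M)"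
  using series_algebra_simps by (simp_all add: cyc_peak_algebra_def)

lemma cyc_algebra_closed:
  "\<one>\<^bsub>cyc_algebra cPk_cyc\<^esub> \<in> carrier (cyc_algebra cPk_cyc)"
  "\<zero>\<^bsub>cyc_algebra cPk_cyc\<^esub> \<in> carrier (cyc_algebra cPk_cyc)"
  "a \<in> carrier (cyc_algebra cPk_cyc) \<Longrightarrow> b \<in> carrier (cyc_algebra cPk_cyc) \<Longrightarrow>
    a \<oplus>\<^bsub>cyc_algebra cPk_cyc\<^esub> b \<in> carrier (cyc_algebra cPk_cyc)"
  "a \<in> carrier (cyc_algebra cPk_cyc) \<Longrightarrow>
    r \<odot>\<^bsub>cyc_algebra cPk_cyc\<^esub> a \<in> carrier (cyc_algebra cPk_cyc)"
  unfolding cyc_algebra_simps by (intro carrier_closed Nil_in_perms; assumption)+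

lemma to_series_linear:
  "to_series \<zero>\<^bsub>cyc_algebra cPk_cyc\<^esub> = (\<lambda>M. 0)"
  "to_series (a \<oplus>\<^bsub>cyc_algebra cPk_cyc\<^esub> b) = (\<lambda>M. to_series a M + to_series b M)"
  "to_series (r \<odot>\<^bsub>cyc_algebra cPk_cyc\<^esub> a) = (\<lambda>M. r * to_series a M)"
  unfolding cyc_algebra_simps by (rule ext, simp only: to_series_zero to_series_add to_series_smult)+

lemma algebra_cyc_algebra: "algebra rat_ring (cyc_algebra cPk_cyc)"
  by (rule algebra_of_injective_hom[OF algebra_series inj_on_to_series];
      (simp only: series_algebra_simps to_series_linear to_series_one to_series_mult
        cyc_algebra_closed mult_carrier subset_UNIV))

lemma algebra_cyc_peak_algebra: "algebra rat_ring cyc_peak_algebra"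
proof (rule algebra_of_injective_hom[OF algebra_series, of "\<lambda>f. f"])
  show "\<one>\<^bsub>cyc_peak_algebra\<^esub> \<in> carrier cyc_peak_algebra"
    using cyc_algebra_closed(1) unfolding carrier_cyc_peak_algebra cyc_peak_algebra_simps
    by (metis to_series_one imageI)
  show "\<zero>\<^bsub>cyc_peak_algebra\<^esub> \<in> carrier cyc_peak_algebra"
    unfolding carrier_cyc_peak_algebra cyc_peak_algebra_simps
    by (rule image_eqI[OF _ carrier_closed(1)]) (simp add: to_series_zero fun_eq_iff)
  fix f g assume "f \<in> carrier cyc_peak_algebra"
  then obtain a where a: "a \<in> carrier (cyc_algebra cPk_cyc)" "f = to_series a"
    unfolding carrier_cyc_peak_algebra by blast
  show "r \<odot>\<^bsub>cyc_peak_algebra\<^esub> f \<in> carrier cyc_peak_algebra" for r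
    unfolding carrier_cyc_peak_algebra cyc_peak_algebra_simps
    by (rule image_eqI[OF _ carrier_closed(3)[OF a(1), of r]]) (simp add: to_series_smult a(2) fun_eq_iff)
  assume "g \<in> carrier cyc_peak_algebra"
  then obtain b where b: "b \<in> carrier (cyc_algebra cPk_cyc)" "g = to_series b"
    unfolding carrier_cyc_peak_algebra by blast
  show "f \<otimes>\<^bsub>cyc_peak_algebra\<^esub> g \<in> carrier cyc_peak_algebra"
    unfolding carrier_cyc_peak_algebra cyc_peak_algebra_simps
    using to_series_mult[OF a(1) b(1)] mult_carrier[OF a(1) b(1)] a(2) b(2) by (metis imageI)
  show "f \<oplus>\<^bsub>cyc_peak_algebra\<^esub> g \<in> carrier cyc_peak_algebra"
    unfolding carrier_cyc_peak_algebra cyc_peak_algebra_simps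
    by (rule image_eqI[OF _ carrier_closed(2)[OF a(1) b(1)]])
      (simp add: to_series_add a(2) b(2) fun_eq_iff)
qed (simp_all only: series_algebra_simps cyc_peak_algebra_simps subset_UNIV inj_on_id2)

lemma to_series_algebra_iso: "to_series \<in> algebra_iso rat_ring (cyc_algebra cPk_cyc) cyc_peak_algebra"
proof -
  have "to_series \<in> ring_hom (cyc_algebra cPk_cyc) cyc_peak_algebra"
    by (rule ring_hom_memI;
        (simp only: carrier_cyc_peak_algebra cyc_peak_algebra_simps to_series_linear
          to_series_one to_series_mult imageI))
  moreover have "bij_betw to_series (carrier (cyc_algebra cPk_cyc)) (carrier cyc_peak_algebra)"
    using inj_on_to_series by (simp only: bij_betw_def carrier_cyc_peak_algebra)
  ultimately show ?thesis
    unfolding algebra_iso_def ring_iso_def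
    by (intro CollectI conjI ballI;
        (assumption | simp only: cyc_peak_algebra_simps to_series_linear))
qed

theorem corollary4p6:
  shows "cyclic_shuffle_compatible cPk_cyc \<and>
    algebra rat_ring (cyc_algebra cPk_cyc) \<and>
    algebra rat_ring cyc_peak_algebra \<and>
    (\<exists>\<Phi> \<in> algebra_iso rat_ring (cyc_algebra cPk_cyc) cyc_peak_algebra.
       \<forall>p\<in>perms. \<Phi> (basis (cyc_class cPk_cyc (cyc p))) = cyc_peak_fun (length p) (cPk p))"
proof (intro conjI bexI[OF _ to_series_algebra_iso] ballI
    cyclic_shuffle_compatible_cPk_cyc algebra_cyc_algebra algebra_cyc_peak_algebra)
  show "to_series (basis (cPk_class p)) = cyc_peak_fun (length p) (cPk p)" if "p \<in> perms" for p
    using class_fun_cPk_class[OF that] by (simp only: to_series_basis)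
qed

end
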